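(* Let $r\ge1$, $s_1>0$, $s_2=(s_{2,1},\dots,s_{2,r})$ with all $s_{2,l}>0$, $s_{2,0}=\min_{1\le l\le r}s_{2,l}$, and $1\le p,q\le\infty$ with $\min\{s_1,s_{2,0}\}\ge\max\{1/p,1/2\}$; let $A>0$. Assume there exist $\nu>0$ and constants $0<C_1\le C_2$, independent of $m$ and $\mathbf u$, such that $C_1|m|^{-2\nu}\le|g_m(\mathbf u)|^2\le C_2|m|^{-2\nu}$ for all $m$ and all $\mathbf u\in[0,1]^r$. Then there is $C>0$ independent of $\varepsilon$ such that, as $\varepsilon\to0$, $$R_\varepsilon\big(B^{s_1,s_2}_{p,q}(A)\big)\ge CA^2\left(\frac{\varepsilon^2}{A^2}\right)^{D},\qquad D=\min\left(\frac{2s_{2,0}}{2s_{2,0}+1},\frac{2s_1}{2s_1+2\nu+1},\frac{2s_1'}{2s_1'+2\nu}\right),$$ with $s_1'=s_1+\frac12-\frac1{p'}$, $p'=\min\{p,2\}$.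
   Context: Model: for $\varepsilon>0$ one observes $y(\mathbf u,t)=\int_0^1 g(\mathbf u,t-x)f(\mathbf u,x)\,dx+\varepsilon z(\mathbf u,t)$, $\mathbf u=(u_1,\dots,u_r)\in[0,1]^r$, $t\in[0,1]$, where $f,g$ are periodic (period 1) in the last argument, $g$ is known, and $z$ is an $(r+1)$-dimensional Gaussian white noise. $e_m(t)=e^{i2\pi mt}$, $g_m(\mathbf u)=\int_0^1 g(\mathbf u,t)\overline{e_m(t)}dt$. Wavelets: $\{\psi_{j,k}\}$ periodized band-limited (Meyer-type) basis of $L^2[0,1]$ with coarsest level $m_0$; $\{\eta_{j',k'}\}$ periodized compactly supported $s_0$-regular (Daubechies-type) basis with coarsest level $m_0'$, where $s_0\ge\max_l s_{2,l}$. Hyperbolic expansion: $f(\mathbf u,t)=\sum_{j,k}\sum_{\mathbf j',\mathbf k'}\beta_{j,k,\mathbf j',\mathbf k'}\psi_{j,k}(t)\prod_{l=1}^r\eta_{j'_l,k'_l}(u_l)$, $\mathbf j'=(j'_1,\dots,j'_r)$, $\mathbf k'=(k'_1,\dots,k'_r)$, $0\le k'_l\le2^{j'_l}-1$. Besov ball: with $s_1^*=s_1+\frac12-\frac1p$, $s_{2,l}^*=s_{2,l}+\frac12-\frac1p$, $B^{s_1,s_2}_{p,q}(A)$ is the set of $f\in L^2([0,1]^{r+1})$ with $\Big(\sum_{j,\mathbf j'}2^{[js_1^*+\sum_{l=1}^r j'_ls_{2,l}^*]q}\big(\sum_{k,\mathbf k'}|\beta_{j,k,\mathbf j',\mathbf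 k'}|^p\big)^{q/p}\Big)^{1/q}\le A$. $R_\varepsilon(V)=\inf_{\tilde f}\sup_{f\in V}\mathbb E\|\tilde f-f\|^2$ over all estimators based on $y$ ($L^2$ norm). *)

theory Defs
  imports "HOL-Probability.Probability"
begin

definition unit_cube :: "(real^'r) set" where
  "unit_cube = {u. \<forall>l. 0 \<le> u$l \<and> u$l \<le> 1}"

definition Dom :: "((real^'r) \<times> real) measure" where
  "Dom = restrict_space lborel (unit_cube \<times> {0..1})"

definition I01 :: "real measure" where
  "I01 = restrict_space lborel {0..1}"

definition L2 :: "'a measure \<Rightarrow> ('a \<Rightarrow> real) set" where
  "L2 M = {h. h \<in> borel_measurable M \<and> (\<integral>\<^sup>+ x. ennreal ((h x)\<^sup>2) \<partial>M) < \<infinity>}"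

definition ip :: "'a measure \<Rightarrow> ('a \<Rightarrow> real) \<Rightarrow> ('a \<Rightarrow> real) \<Rightarrow> real" where
  "ip M h k = (\<integral> x. h x * k x \<partial>M)"

definition orthonormal_basis :: "'a measure \<Rightarrow> 'i set \<Rightarrow> ('i \<Rightarrow> 'a \<Rightarrow> real) \<Rightarrow> bool" where
  "orthonormal_basis M I b \<longleftrightarrow>
     (\<forall>i\<in>I. b i \<in> L2 M) \<and>
     (\<forall>i\<in>I. \<forall>i'\<in>I. ip M (b i) (b i') = (if i = i' then 1 else 0)) \<and>
     (\<forall>h\<in>L2 M. (\<forall>i\<in>I. ip M h (b i) = 0) \<longrightarrow> (AE x in M. h x = 0))"

definition fourier_coeff :: "(real \<Rightarrow> real) \<Rightarrow> int \<Rightarrow> complex" where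
  "fourier_coeff h m = (\<integral> t. complex_of_real (h t) * cis (- 2 * pi * real_of_int m * t) \<partial>I01)"

text \<open>Index set of a periodized wavelet basis with coarsest level m0, using the usual
  convention that level m0-1 carries the 2^m0 scaling functions and level j >= m0 the
  2^j wavelets.\<close>
definition wav_index :: "int \<Rightarrow> (int \<times> nat) set" where
  "wav_index m0 = {(j,k). m0 - 1 \<le> j \<and> k < 2 ^ nat (max j m0)}"

definition periodic1 :: "(real \<Rightarrow> real) \<Rightarrow> bool" where
  "periodic1 h \<longleftrightarrow> (\<forall>x. h (x + 1) = h x)"

definition band_limited_basis :: "int \<Rightarrow> (int \<Rightarrow> nat \<Rightarrow> real \<Rightarrow> real) \<Rightarrow> bool" where
  "band_limited_basis m0 \<psi> \<longleftrightarrow>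
     orthonormal_basis I01 (wav_index m0) (\<lambda>(j,k). \<psi> j k) \<and>
     (\<forall>(j,k)\<in>wav_index m0. periodic1 (\<psi> j k)) \<and>
     (\<exists>c>1. \<forall>(j,k)\<in>wav_index m0. \<forall>m. fourier_coeff (\<psi> j k) m \<noteq> 0 \<longrightarrow>
        (if j = m0 - 1 then \<bar>real_of_int m\<bar> \<le> c * 2 powr real_of_int m0
         else 2 powr real_of_int j / c \<le> \<bar>real_of_int m\<bar> \<and> \<bar>real_of_int m\<bar> \<le> c * 2 powr real_of_int j))"

definition C_n :: "nat \<Rightarrow> (real \<Rightarrow> real) \<Rightarrow> bool" where
  "C_n n h \<longleftrightarrow> (\<exists>D :: nat \<Rightarrow> real \<Rightarrow> real. D 0 = h \<and>
      (\<forall>i<n. \<forall>x. (D i has_real_derivative D (Suc i) x) (at x)) \<and> continuous_on UNIV (D n))"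

definition compact_regular_basis :: "int \<Rightarrow> nat \<Rightarrow> (int \<Rightarrow> nat \<Rightarrow> real \<Rightarrow> real) \<Rightarrow> bool" where
  "compact_regular_basis m0 s0 \<eta> \<longleftrightarrow>
     orthonormal_basis I01 (wav_index m0) (\<lambda>(j,k). \<eta> j k) \<and>
     (\<forall>(j,k)\<in>wav_index m0. periodic1 (\<eta> j k) \<and> C_n s0 (\<eta> j k)) \<and>
     (\<exists>c>0. \<forall>(j,k)\<in>wav_index m0. \<exists>a. \<forall>x. \<eta> j k x \<noteq> 0 \<longrightarrow>
        (\<exists>n::int. a \<le> x + real_of_int n \<and> x + real_of_int n \<le> a + c * 2 powr (- real_of_int j)))"

definition beta :: "(int \<Rightarrow> nat \<Rightarrow> real \<Rightarrow> real) \<Rightarrow> (int \<Rightarrow> nat \<Rightarrow> real \<Rightarrow> real) \<Rightarrow>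
    ((real^'r) \<times> real \<Rightarrow> real) \<Rightarrow> int \<Rightarrow> nat \<Rightarrow> ('r \<Rightarrow> int) \<Rightarrow> ('r \<Rightarrow> nat) \<Rightarrow> real" where
  "beta \<psi> \<eta> f j k j' k' =
     (\<integral> x. f x * \<psi> j k (snd x) * (\<Prod>l\<in>UNIV. \<eta> (j' l) (k' l) (fst x $ l)) \<partial>Dom)"

definition level_set :: "int \<Rightarrow> int \<Rightarrow> (int \<times> ('r \<Rightarrow> int)) set" where
  "level_set m0 m0' = {(j,j'). m0 - 1 \<le> j \<and> (\<forall>l. m0' - 1 \<le> j' l)}"

definition shift_set :: "int \<Rightarrow> int \<Rightarrow> int \<Rightarrow> ('r \<Rightarrow> int) \<Rightarrow> (nat \<times> ('r \<Rightarrow> nat)) set" where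
  "shift_set m0 m0' j j' = {(k,k'). k < 2 ^ nat (max j m0) \<and> (\<forall>l. k' l < 2 ^ nat (max (j' l) m0'))}"

definition invp :: "ereal \<Rightarrow> real" where
  "invp p = (if p = \<infinity> then 0 else 1 / real_of_ereal p)"

definition lp_norm :: "ereal \<Rightarrow> ('a \<Rightarrow> real) \<Rightarrow> 'a set \<Rightarrow> real" where
  "lp_norm p F S = (if p = \<infinity> then Max ((\<lambda>x. \<bar>F x\<bar>) ` S)
      else (\<Sum>x\<in>S. \<bar>F x\<bar> powr real_of_ereal p) powr (1 / real_of_ereal p))"

definition besov_ball :: "(int \<Rightarrow> nat \<Rightarrow> real \<Rightarrow> real) \<Rightarrow> (int \<Rightarrow> nat \<Rightarrow> real \<Rightarrow> real) \<Rightarrow> int \<Rightarrow> int \<Rightarrow>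
    real \<Rightarrow> ('r \<Rightarrow> real) \<Rightarrow> ereal \<Rightarrow> ereal \<Rightarrow> real \<Rightarrow> ((real^'r) \<times> real \<Rightarrow> real) set" where
  "besov_ball \<psi> \<eta> m0 m0' s1 s2 p q A =
     {f. f \<in> L2 Dom \<and>
        (let w = (\<lambda>(j,j'). 2 powr (real_of_int j * (s1 + 1/2 - invp p)
                    + (\<Sum>l\<in>UNIV. real_of_int (j' l) * (s2 l + 1/2 - invp p)))
                  * lp_norm p (\<lambda>(k,k'). beta \<psi> \<eta> f j k j' k') (shift_set m0 m0' j j'))
         in if q = \<infinity> then (\<forall>x\<in>level_set m0 m0'. w x \<le> A)
            else (\<integral>\<^sup>+ x. ennreal (w x powr real_of_ereal q) \<partial>count_space (level_set m0 m0'))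
                   \<le> ennreal (A powr real_of_ereal q))}"

definition conv :: "(real^'r \<Rightarrow> real \<Rightarrow> real) \<Rightarrow> ((real^'r) \<times> real \<Rightarrow> real) \<Rightarrow> (real^'r) \<times> real \<Rightarrow> real" where
  "conv g f = (\<lambda>(u,t). \<integral> x. g u (t - x) * f (u,x) \<partial>I01)"

text \<open>The white-noise observation y = g*f + eps z, recorded through a complete orthonormal
  system phi of L2([0,1]^(r+1)): Y_n = <g*f, phi_n> + eps xi_n, xi_n iid N(0,1).\<close>
definition obs_law :: "(real^'r \<Rightarrow> real \<Rightarrow> real) \<Rightarrow> (nat \<Rightarrow> (real^'r) \<times> real \<Rightarrow> real) \<Rightarrow> real \<Rightarrow>
    ((real^'r) \<times> real \<Rightarrow> real) \<Rightarrow> (nat \<Rightarrow> real) measure" where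
  "obs_law g \<phi> \<epsilon> f = (\<Pi>\<^sub>M n\<in>UNIV. density lborel (normal_density (ip Dom (conv g f) (\<phi> n)) \<epsilon>))"

definition estimators :: "((nat \<Rightarrow> real) \<Rightarrow> (real^'r) \<times> real \<Rightarrow> real) set" where
  "estimators = {fe. (\<lambda>(\<omega>,x). fe \<omega> x) \<in> borel_measurable ((\<Pi>\<^sub>M n\<in>UNIV. (borel :: real measure)) \<Otimes>\<^sub>M Dom)}"

definition minimax_risk :: "(real^'r \<Rightarrow> real \<Rightarrow> real) \<Rightarrow> (nat \<Rightarrow> (real^'r) \<times> real \<Rightarrow> real) \<Rightarrow> real \<Rightarrow>
    ((real^'r) \<times> real \<Rightarrow> real) set \<Rightarrow> ennreal" where
  "minimax_risk g \<phi> \<epsilon> V = (INF fe\<in>estimators. SUP f\<in>V.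
      \<integral>\<^sup>+ \<omega>. (\<integral>\<^sup>+ x. ennreal ((fe \<omega> x - f x)\<^sup>2) \<partial>Dom) \<partial>obs_law g \<phi> \<epsilon> f)"

end

theory Submission
  imports Defs
begin

text \<open>
  Fix a single wavelet level \<open>(j, j')\<close> and put the coefficient \<open>0\<close> or \<open>\<gamma>\<close> on each of \<open>N\<close> tensor
  wavelets of that level. Since \<open>\<psi>\<^bsub>j,k\<^esub>\<close> is a trigonometric polynomial with frequencies of order
  \<open>2^j\<close>, convolution with \<open>g\<close> shrinks each perturbation to an \<open>L\<^sup>2\<close> norm of order \<open>\<gamma> 2^(-j\<nu>)\<close>. As soon
  as this is at most \<open>\<epsilon>\<close>, no test distinguishes two functions that differ in a single coefficient
  (a chi-square bound between the two Gaussian product laws), and Assouad's lemma gives a risk of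
  order \<open>N \<gamma>\<^sup>2\<close>. The three terms of the exponent come from three choices: all \<open>2^j\<close> wavelets in the
  variable \<open>t\<close>; a single wavelet in \<open>t\<close>; all \<open>2^n\<close> wavelets in the coordinate \<open>u\<^sub>l\<close> of least smoothness,
  with \<open>t\<close> kept at the coarsest level. The level \<open>j = m0\<close>, rather than the scaling level \<open>m0 - 1\<close>,
  avoids frequency \<open>0\<close>, where nothing is assumed about \<open>g\<close>.
\<close>

section \<open>Testing between Gaussian sequence models\<close>

text \<open>Assouad's lemma compares only neighbouring vertices of the cube, so the images
  \<open>conv g (b i)\<close> need not be orthogonal: the norm of each one enters, and Bessel's
  inequality for \<open>\<phi>\<close> turns it into a bound on the shift of the Gaussian means.
  That norm is the analytic obstacle. The kernel is known through the moduli of its Fourier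
  coefficients, and for small \<open>\<nu>\<close> the function \<open>g u\<close> need not be
  square integrable. The wavelet is therefore replaced a.e. by its finite Fourier sum, on which
  convolution acts diagonally; this replacement rests on uniqueness of Fourier coefficients for
  integrable functions. The three choices are one computation with exponent
  \<open>2 * \<sigma> / (2 * \<tau> + 2 * \<mu>)\<close>. The triple
  \<open>(\<tau>, \<mu>, \<sigma>)\<close> is \<open>(s1 + 1/2, \<nu>, s1)\<close> for all wavelets
  in \<open>t\<close>, \<open>(\<tau>, \<nu>, \<tau>)\<close> with
  \<open>\<tau> = s1 + 1/2 - invp p\<close> for a single one, and
  \<open>(s2 l + 1/2, 0, s2 l)\<close> for the wavelets in the coordinate \<open>l\<close>. The
  constant 128 is 16 * 8: a testing error of 1/16, and a loss of 8 in Assouad's lemma.\<close>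

lemma finite_measure_approx_algebra:
  assumes M: "finite_measure M" and N: "finite_measure N" and MN: "sets N = sets M"
    and alg: "algebra (space M) G" and gen: "sets M = sigma_sets (space M) G"
    and B: "B \<in> sets M" and e: "0 < e"
  shows "\<exists>C\<in>G. measure M (sym_diff B C) < e \<and> measure N (sym_diff B C) < e"
proof -
  interpret M: finite_measure M by fact
  interpret N: finite_measure N by fact
  interpret algebra "space M" G by fact
  have G: "G \<subseteq> sets M" using gen by auto
  have "B \<in> sigma_sets (space M) G" using B gen by simp
  then show ?thesis using e
  \<comment> \<open>The sets that can be approximated for every \<open>e\<close> form a
    sigma-algebra containing \<open>G\<close>. The tolerance stays arbitrary because a countable
    union distributes it over its members.\<close>
  proof (induction B arbitrary: e)
    case (Basic a)
    then show ?case by (intro bexI[of _ a]) auto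
  next
    case Empty
    then show ?case by (intro bexI[of _ "{}"]) auto
  next
    case (Compl a)
    then obtain C where C: "C \<in> G" "measure M (sym_diff a C) < e" "measure N (sym_diff a C) < e"
      by blast
    have "a \<subseteq> space M" "C \<subseteq> space M"
      using Compl(1) C(1) sigma_sets_into_sp[OF space_closed] space_closed by auto
    then have "sym_diff (space M - a) (space M - C) = sym_diff a C" by blast
    then show ?case using C by (intro bexI[of _ "space M - C"]) auto
  next
    case (Union a)
    have a: "a i \<in> sets M" for i using Union(1) gen by simp
    have tail: "\<exists>n0. \<forall>n\<ge>n0. measure K ((\<Union>i. a i) - (\<Union>i<n. a i)) < e/2"
      if "finite_measure K" "sets K = sets M" for K
    proof -
      interpret K: finite_measure K by fact
      have aK: "a i \<in> sets K" for i using a that by simp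
      have "(\<lambda>n. measure K (\<Union>i<n. a i)) \<longlonglongrightarrow> measure K (\<Union>n. \<Union>i<n. a i)"
      proof (rule K.finite_Lim_measure_incseq)
        show "incseq (\<lambda>n. \<Union>i<n. a i)" unfolding incseq_def by (intro allI impI UN_mono) auto
      qed (use aK in auto)
      moreover have "(\<Union>n. \<Union>i<n. a i) = (\<Union>i. a i)" by blast
      ultimately have "(\<lambda>n. measure K (\<Union>i<n. a i)) \<longlonglongrightarrow> measure K (\<Union>i. a i)" by simp
      from this[THEN LIMSEQ_D, of "e/2"] Union(3) obtain n0 where
        n0: "\<And>n. n \<ge> n0 \<Longrightarrow> \<bar>measure K (\<Union>i<n. a i) - measure K (\<Union>i. a i)\<bar> < e/2"
        by auto
      have "measure K ((\<Union>i. a i) - (\<Union>i<n. a i)) = measure K (\<Union>i. a i) - measure K (\<Union>i<n. a i)" for n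
        using aK by (intro K.finite_measure_Diff) auto
      then show ?thesis using n0 by (intro exI[of _ n0] allI impI) (smt (verit))
    qed
    obtain n1 n2 where n: "\<forall>n\<ge>n1. measure M ((\<Union>i. a i) - (\<Union>i<n. a i)) < e/2"
      "\<forall>n\<ge>n2. measure N ((\<Union>i. a i) - (\<Union>i<n. a i)) < e/2"
      using tail[OF M refl] tail[OF N MN] by blast
    \<comment> \<open>One cut-off past both thresholds, so that a single set serves both measures.
      The \<open>+ 1\<close> keeps \<open>n\<close> positive, as the share \<open>e/(2*n)\<close> of
      each member requires.\<close>
    define n where "n = n1 + n2 + 1"
    have "\<forall>i. \<exists>C\<in>G. measure M (sym_diff (a i) C) < e/(2*n) \<and> measure N (sym_diff (a i) C) < e/(2*n)"
      using Union(2,3) by (auto simp: n_def)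
    then obtain C where C: "\<And>i. C i \<in> G" "\<And>i. measure M (sym_diff (a i) (C i)) < e/(2*n)"
        "\<And>i. measure N (sym_diff (a i) (C i)) < e/(2*n)" by metis
    have sub: "sym_diff (\<Union>i. a i) (\<Union>i<n. C i) \<subseteq>
       ((\<Union>i. a i) - (\<Union>i<n. a i)) \<union> (\<Union>i<n. sym_diff (a i) (C i))" by blast
    have bd: "measure K (sym_diff (\<Union>i. a i) (\<Union>i<n. C i)) < e"
      if "finite_measure K" "sets K = sets M" "\<And>i. measure K (sym_diff (a i) (C i)) < e/(2*n)"
        "measure K ((\<Union>i. a i) - (\<Union>i<n. a i)) < e/2" for K
    proof -
      interpret K: finite_measure K by fact
      have s [measurable]: "a i \<in> sets K" "C i \<in> sets K" for i using a C(1) G that by auto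
      have "measure K (sym_diff (\<Union>i. a i) (\<Union>i<n. C i)) \<le>
         measure K (((\<Union>i. a i) - (\<Union>i<n. a i)) \<union> (\<Union>i<n. sym_diff (a i) (C i)))"
        by (rule K.finite_measure_mono[OF sub]) measurable
      also have "\<dots> \<le> measure K ((\<Union>i. a i) - (\<Union>i<n. a i)) + measure K (\<Union>i<n. sym_diff (a i) (C i))"
        by (rule measure_Un_le) measurable
      also have "measure K (\<Union>i<n. sym_diff (a i) (C i)) \<le> (\<Sum>i<n. measure K (sym_diff (a i) (C i)))"
        by (rule measure_UNION_le) auto
      also have "\<dots> \<le> (\<Sum>i<n. e/(2*n))" by (intro sum_mono less_imp_le that)
      also have "\<dots> = e/2"
      proof -
        have "n > 0" by (simp add: n_def)
        then show ?thesis by simp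
      qed
      finally show ?thesis using that(4) by simp
    qed
    show ?case
      using C(1) bd[OF M refl C(2)] bd[OF N MN C(3)] n by (intro bexI[of _ "\<Union>i<n. C i"]) (auto simp: n_def)
  qed
qed

text \<open>Completing the square: \<open>2(x-b)^2 - (x-a)^2 = (x-(2b-a))^2 - 2(b-a)^2\<close>. The
  chi-square integrand is thus a multiple of another Gaussian density, and its integral can be read
  off.\<close>

lemma normal_density_chi_square:
  assumes "\<sigma> > 0"
  shows "(normal_density b \<sigma> x)\<^sup>2 / normal_density a \<sigma> x
     = exp ((b - a)\<^sup>2 / \<sigma>\<^sup>2) * normal_density (2 * b - a) \<sigma> x"
proof -
  have e: "- (x - b)\<^sup>2 / (2 * \<sigma>\<^sup>2) * 2 - (- (x - a)\<^sup>2 / (2 * \<sigma>\<^sup>2))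
      = (b - a)\<^sup>2 / \<sigma>\<^sup>2 + (- (x - (2 * b - a))\<^sup>2 / (2 * \<sigma>\<^sup>2))"
    using assms by (simp add: field_simps power2_eq_square)
  have "(normal_density b \<sigma> x)\<^sup>2 / normal_density a \<sigma> x
     = 1 / sqrt (2 * pi * \<sigma>\<^sup>2) * exp (- (x - b)\<^sup>2 / (2 * \<sigma>\<^sup>2) * 2 - (- (x - a)\<^sup>2 / (2 * \<sigma>\<^sup>2)))"
  proof -
    define s u v where "s = sqrt (2 * pi * \<sigma>\<^sup>2)" and "u = exp (- (x - b)\<^sup>2 / (2 * \<sigma>\<^sup>2))"
      and "v = exp (- (x - a)\<^sup>2 / (2 * \<sigma>\<^sup>2))"
    have "s > 0" "v > 0" using assms by (simp_all add: s_def v_def)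
    then have "(1 / s * u)\<^sup>2 / (1 / s * v) = 1 / s * (u\<^sup>2 / v)" by (simp add: field_simps power2_eq_square)
    moreover have "u\<^sup>2 = exp (- (x - b)\<^sup>2 / (2 * \<sigma>\<^sup>2) * 2)"
      by (simp only: u_def power2_eq_square mult_2_right exp_add)
    ultimately show ?thesis by (simp only: normal_density_def s_def u_def v_def exp_diff)
  qed
  also have "\<dots> = exp ((b - a)\<^sup>2 / \<sigma>\<^sup>2) * normal_density (2 * b - a) \<sigma> x"
    unfolding e exp_add normal_density_def by simp
  finally show ?thesis .
qed

text \<open>Tonelli on boxes, which determine a finite product of sigma-finite measures.\<close>

lemma PiM_density:
  assumes J: "finite J" and f: "\<And>i. i \<in> J \<Longrightarrow> f i \<in> borel_measurable lborel"
    and sf: "\<And>i. sigma_finite_measure (density lborel (f i))"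
  shows "PiM J (\<lambda>i. density lborel (f i)) = density (PiM J (\<lambda>_. lborel)) (\<lambda>x. \<Prod>i\<in>J. f i (x i :: real))"
proof -
  interpret P: product_sigma_finite "\<lambda>i. density lborel (f i)" using sf by unfold_locales
     (auto simp: sigma_finite_measure_def)
  interpret L: product_sigma_finite "\<lambda>_. lborel :: real measure" by unfold_locales
  have m [measurable]: "(\<lambda>x. \<Prod>i\<in>J. f i (x i)) \<in> borel_measurable (PiM J (\<lambda>_. lborel))"
  proof (rule borel_measurable_prod_ennreal)
    fix i assume i: "i \<in> J"
    have "(\<lambda>x. x i) \<in> measurable (PiM J (\<lambda>_. lborel)) lborel"
      using i by (rule measurable_component_singleton)
    then show "(\<lambda>x. f i (x i)) \<in> borel_measurable (PiM J (\<lambda>_. lborel))"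
      using f[OF i] by (rule measurable_compose)
  qed
  show ?thesis
  proof (rule P.PiM_eqI[OF J, symmetric])
    show "sets (density (PiM J (\<lambda>_. lborel)) (\<lambda>x. \<Prod>i\<in>J. f i (x i))) = PiM J (\<lambda>i. density lborel (f i))"
      by (simp cong: sets_PiM_cong)
  next
    fix A assume A: "\<And>i. i \<in> J \<Longrightarrow> A i \<in> sets (density lborel (f i))"
    have AE: "Pi\<^sub>E J A \<in> sets (PiM J (\<lambda>_. lborel))" using A J by (intro sets_PiM_I_finite) auto
    have "emeasure (density (PiM J (\<lambda>_. lborel)) (\<lambda>x. \<Prod>i\<in>J. f i (x i))) (Pi\<^sub>E J A)
       = (\<integral>\<^sup>+x. (\<Prod>i\<in>J. f i (x i) * indicator (A i) (x i)) \<partial>PiM J (\<lambda>_. lborel))"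
      unfolding emeasure_density[OF m AE]
    proof (rule nn_integral_cong)
      fix x assume "x \<in> space (PiM J (\<lambda>_. lborel :: real measure))"
      then have "x \<in> Pi\<^sub>E J A \<longleftrightarrow> (\<forall>i\<in>J. x i \<in> A i)" by (auto simp: space_PiM PiE_iff)
      then have "indicator (Pi\<^sub>E J A) x = (\<Prod>i\<in>J. indicator (A i) (x i) :: ennreal)"
        using J by (auto simp: indicator_def prod_zero_iff)
      then show "(\<Prod>i\<in>J. f i (x i)) * indicator (Pi\<^sub>E J A) x = (\<Prod>i\<in>J. f i (x i) * indicator (A i) (x i))"
        by (simp add: prod.distrib)
    qed
    also have "\<dots> = (\<Prod>i\<in>J. \<integral>\<^sup>+x. f i x * indicator (A i) x \<partial>lborel)"
      using A f by (intro L.product_nn_integral_prod J borel_measurable_times borel_measurable_indicator) auto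
    also have "\<dots> = (\<Prod>i\<in>J. emeasure (density lborel (f i)) (A i))"
      using A f by (intro prod.cong refl emeasure_density[symmetric]) auto
    finally show "emeasure (density (PiM J (\<lambda>_. lborel)) (\<lambda>x. \<Prod>i\<in>J. f i (x i))) (Pi\<^sub>E J A)
      = (\<Prod>i\<in>J. emeasure (density lborel (f i)) (A i))" .
  qed
qed

text \<open>Cauchy-Schwarz after writing the density \<open>p b\<close> on \<open>X\<close> as
  \<open>sqrt (p a)\<close> times \<open>p b / sqrt (p a)\<close>. The first factor gives the
  probability of \<open>X\<close> under \<open>a\<close>; the second is the chi-square integral,
  which factorises over the coordinates.\<close>

lemma finite_gaussian_chi_square:
  assumes \<sigma>: "\<sigma> > 0" and J: "finite J"
    and X: "X \<in> sets (PiM J (\<lambda>_. borel))"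
  shows "(emeasure (PiM J (\<lambda>n. density lborel (normal_density (b n) \<sigma>))) X)\<^sup>2
     \<le> ennreal (exp ((\<Sum>n\<in>J. (b n - a n)\<^sup>2) / \<sigma>\<^sup>2)) *
        emeasure (PiM J (\<lambda>n. density lborel (normal_density (a n) \<sigma>))) X"
proof -
  let ?L = "PiM J (\<lambda>_. lborel :: real measure)"
  interpret L: product_sigma_finite "\<lambda>_. lborel :: real measure" by unfold_locales
  note pos = normal_density_pos[OF \<sigma>]
  have sf: "sigma_finite_measure (density lborel (normal_density c \<sigma>))" for c
    using prob_space_normal_density[OF \<sigma>] by (simp add: prob_space_imp_sigma_finite)
  define p where "p c x = (\<Prod>n\<in>J. normal_density (c n) \<sigma> (x n))" for c :: "'a \<Rightarrow> real" and x
  have p_pos: "p c x > 0" for c x unfolding p_def by (intro prod_pos pos) 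
  have pm [measurable]: "p c \<in> borel_measurable ?L" for c
    unfolding p_def by measurable
  have Xs [measurable]: "X \<in> sets ?L" using X by (simp cong: sets_PiM_cong)
  have dens: "PiM J (\<lambda>n. density lborel (normal_density (c n) \<sigma>)) = density ?L (p c)" for c
    unfolding p_def by (subst PiM_density[OF J]) (auto simp: sf prod_ennreal)
  have em: "emeasure (density ?L (p c)) X = (\<integral>\<^sup>+x. ennreal (p c x) * indicator X x \<partial>?L)" for c
    by (rule emeasure_density) auto
  have "(\<integral>\<^sup>+x. ennreal (p b x) * indicator X x \<partial>?L)
     = (\<integral>\<^sup>+x. ennreal (sqrt (p a x) * indicator X x) * ennreal (p b x / sqrt (p a x)) \<partial>?L)"
  proof (intro nn_integral_cong)
    fix x
    have "sqrt (p a x) * (p b x / sqrt (p a x)) = p b x" using p_pos[of a x] by simp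
    then show "ennreal (p b x) * indicator X x
      = ennreal (sqrt (p a x) * indicator X x) * ennreal (p b x / sqrt (p a x))"
      using p_pos[of a x] p_pos[of b x] by (simp add: indicator_def flip: ennreal_mult'')
  qed
  then have "(\<integral>\<^sup>+x. ennreal (p b x) * indicator X x \<partial>?L)\<^sup>2 \<le>
    (\<integral>\<^sup>+x. (ennreal (sqrt (p a x) * indicator X x))\<^sup>2 \<partial>?L) *
    (\<integral>\<^sup>+x. (ennreal (p b x / sqrt (p a x)))\<^sup>2 \<partial>?L)"
    by (simp only:) (rule Cauchy_Schwarz_nn_integral; measurable)
  also have "(\<integral>\<^sup>+x. (ennreal (sqrt (p a x) * indicator X x))\<^sup>2 \<partial>?L) = (\<integral>\<^sup>+x. ennreal (p a x) * indicator X x \<partial>?L)"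
    using p_pos by (intro nn_integral_cong) (auto simp: indicator_def ennreal_power less_imp_le)
  also have "(\<integral>\<^sup>+x. (ennreal (p b x / sqrt (p a x)))\<^sup>2 \<partial>?L)
     = (\<integral>\<^sup>+x. (\<Prod>n\<in>J. ennreal (exp ((b n - a n)\<^sup>2 / \<sigma>\<^sup>2) * normal_density (2 * b n - a n) \<sigma> (x n))) \<partial>?L)"
  proof (intro nn_integral_cong)
    fix x
    have "(ennreal (p b x / sqrt (p a x)))\<^sup>2 = ennreal ((p b x)\<^sup>2 / p a x)"
      using p_pos by (simp add: ennreal_power less_imp_le power_divide)
    also have "(p b x)\<^sup>2 / p a x = (\<Prod>n\<in>J. (normal_density (b n) \<sigma> (x n))\<^sup>2 / normal_density (a n) \<sigma> (x n))"
      by (simp add: p_def prod_power_distrib prod_dividef)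
    finally show "(ennreal (p b x / sqrt (p a x)))\<^sup>2 =
      (\<Prod>n\<in>J. ennreal (exp ((b n - a n)\<^sup>2 / \<sigma>\<^sup>2) * normal_density (2 * b n - a n) \<sigma> (x n)))"
      by (simp add: normal_density_chi_square[OF \<sigma>] prod_ennreal)
  qed
  also have "\<dots> = (\<Prod>n\<in>J. \<integral>\<^sup>+x. ennreal (exp ((b n - a n)\<^sup>2 / \<sigma>\<^sup>2) * normal_density (2 * b n - a n) \<sigma> x) \<partial>lborel)"
    by (rule L.product_nn_integral_prod[OF J]) measurable
  also have "\<dots> = (\<Prod>n\<in>J. ennreal (exp ((b n - a n)\<^sup>2 / \<sigma>\<^sup>2)))"
    using \<sigma> by (intro prod.cong refl) (simp add: ennreal_mult' nn_integral_cmult nn_integral_eq_integral)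
  also have "\<dots> = ennreal (exp ((\<Sum>n\<in>J. (b n - a n)\<^sup>2) / \<sigma>\<^sup>2))"
    using J by (simp add: prod_ennreal exp_sum sum_divide_distrib)
  finally show ?thesis unfolding dens em by (simp add: mult.commute)
qed

text \<open>Cylinder sets approximate \<open>B\<close> under both laws at once, so the finite-dimensional bound carries
  over and no density between the infinite products has to be constructed.\<close>
lemma gaussian_chi_square:
  fixes a b :: "nat \<Rightarrow> real"
  assumes \<sigma>: "\<sigma> > 0" and K: "\<And>J. finite J \<Longrightarrow> (\<Sum>n\<in>J. (b n - a n)\<^sup>2) \<le> \<sigma>\<^sup>2"
    and B: "B \<in> sets (PiM UNIV (\<lambda>_. borel))"
  shows "(measure (PiM UNIV (\<lambda>n. density lborel (normal_density (b n) \<sigma>))) B)\<^sup>2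
     \<le> exp 1 * measure (PiM UNIV (\<lambda>n. density lborel (normal_density (a n) \<sigma>))) B"
proof -
  define M where "M c n = density lborel (normal_density (c n) \<sigma>)" for c :: "nat \<Rightarrow> real" and n
  have pp: "product_prob_space (M c)" for c
    unfolding M_def using prob_space_normal_density[OF \<sigma>] 
    by (auto intro!: product_prob_spaceI)
  interpret A: product_prob_space "M a" UNIV by (rule pp)
  interpret B: product_prob_space "M b" UNIV by (rule pp)
  have sM [simp]: "sets (M c n) = sets borel" "space (M c n) = UNIV" for c n by (simp_all add: M_def)
  have sP: "sets (PiM J (M c)) = sets (PiM J (\<lambda>_. borel))" for J c by (intro sets_PiM_cong) auto
  let ?P = "PiM UNIV (M a)" and ?Q = "PiM UNIV (M b)"
  have fin: "finite_measure ?P" "finite_measure ?Q" by unfold_locales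
  have gen: "(measure ?Q C)\<^sup>2 \<le> exp 1 * measure ?P C" if C: "C \<in> A.generator" for C
    using C
  proof (cases rule: A.generator.cases)
    case (1 J X)
    have X: "X \<in> sets (PiM J (\<lambda>_. borel))" using 1 sP by simp
    have emb: "prod_emb UNIV (M a) J X = prod_emb UNIV (M b) J X"
      by (simp add: prod_emb_def)
    have P: "emeasure ?P C = emeasure (PiM J (M a)) X"
      unfolding 1 by (rule A.emeasure_PiM_emb') (use 1 in auto)
    have Q: "emeasure ?Q C = emeasure (PiM J (M b)) X"
      unfolding 1 emb by (rule B.emeasure_PiM_emb') (use 1 sP X in auto)
    have "(emeasure ?Q C)\<^sup>2 \<le> ennreal (exp ((\<Sum>n\<in>J. (b n - a n)\<^sup>2) / \<sigma>\<^sup>2)) * emeasure ?P C"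
      using finite_gaussian_chi_square[OF \<sigma> \<open>finite J\<close> X, of b a] unfolding P Q M_def .
    also have "\<dots> \<le> ennreal (exp 1) * emeasure ?P C"
      using K[OF \<open>finite J\<close>] \<sigma> by (intro mult_right_mono ennreal_leI) auto
    finally show ?thesis
      unfolding A.P.emeasure_eq_measure B.P.emeasure_eq_measure
      by (simp add: ennreal_power flip: ennreal_mult')
  qed
  have sets_eq: "sets ?Q = sets ?P" by (simp add: sP)
  have BP [measurable]: "B \<in> sets ?P" "B \<in> sets ?Q" using B by (simp_all add: sP)
  have "(measure ?Q B)\<^sup>2 \<le> exp 1 * measure ?P B + e" if e: "e > 0" for e
  proof -
    \<comment> \<open>Replacing \<open>B\<close> by a cylinder \<open>C\<close> costs
      \<open>exp 1 * d\<close> on the right and at most \<open>2 * d\<close> on the left, since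
      squares of probabilities differ by at most twice the difference of the probabilities.\<close>
    define d where "d = e / (2 + exp 1)"
    have d: "d > 0" using e by (simp add: d_def add_pos_pos)
    obtain C where C: "C \<in> A.generator" "measure ?P (sym_diff B C) < d" "measure ?Q (sym_diff B C) < d"
      using finite_measure_approx_algebra[OF fin sets_eq A.algebra_generator A.sets_PiM_generator BP(1) d] by blast
    have [measurable]: "C \<in> sets ?P" using C(1) A.sets_PiM_generator by auto
    then have [measurable]: "C \<in> sets ?Q" using sets_eq by simp
    have 1: "measure ?P C \<le> measure ?P B + d"
    proof -
      have "measure ?P C \<le> measure ?P (B \<union> sym_diff B C)" by (rule A.P.finite_measure_mono) auto
      also have "\<dots> \<le> measure ?P B + measure ?P (sym_diff B C)" by (rule measure_Un_le) auto
      finally show ?thesis using C by simp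
    qed
    have 2: "measure ?Q B \<le> measure ?Q C + d"
    proof -
      have "measure ?Q B \<le> measure ?Q (C \<union> sym_diff B C)" by (rule B.P.finite_measure_mono) auto
      also have "\<dots> \<le> measure ?Q C + measure ?Q (sym_diff B C)" by (rule measure_Un_le) auto
      finally show ?thesis using C by simp
    qed
    have "(measure ?Q B)\<^sup>2 - (measure ?Q C)\<^sup>2 = (measure ?Q B - measure ?Q C) * (measure ?Q B + measure ?Q C)"
      by (simp add: power2_eq_square algebra_simps)
    also have "\<dots> \<le> d * 2"
      using 2 d add_mono[OF B.P.prob_le_1[of B] B.P.prob_le_1[of C]] by (intro mult_mono) auto
    finally have "(measure ?Q B)\<^sup>2 \<le> exp 1 * measure ?P C + 2 * d" using gen[OF C(1)] by simp
    also have "\<dots> \<le> exp 1 * (measure ?P B + d) + 2 * d" using 1 by simp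
    also have "\<dots> = exp 1 * measure ?P B + d * (2 + exp 1)" by (simp add: algebra_simps)
    also have "d * (2 + exp 1) = e" using exp_gt_zero[of "1::real"] unfolding d_def
      by (simp del: exp_gt_zero add: less_imp_neq[THEN not_sym])
    finally show ?thesis .
  qed
  then show ?thesis unfolding M_def by (rule field_le_epsilon)
qed

text \<open>If the second law gives \<open>B\<close> at most 1/2, its complement already has mass
  1/2. Otherwise the chi-square bound and \<open>exp 1 \<le> 3\<close> give \<open>B\<close> mass at
  least 1/12 under the first law; 1/16 is a round value below that.\<close>

lemma gaussian_test_error:
  fixes a b :: "nat \<Rightarrow> real"
  assumes \<sigma>: "\<sigma> > 0" and K: "\<And>J. finite J \<Longrightarrow> (\<Sum>n\<in>J. (b n - a n)\<^sup>2) \<le> \<sigma>\<^sup>2"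
    and B: "B \<in> sets (PiM UNIV (\<lambda>_. borel))"
  shows "ennreal (1/16) \<le> emeasure (PiM UNIV (\<lambda>n. density lborel (normal_density (a n) \<sigma>))) B
     + emeasure (PiM UNIV (\<lambda>n. density lborel (normal_density (b n) \<sigma>))) (- B)"
proof -
  define M where "M c = PiM UNIV (\<lambda>n::nat. density lborel (normal_density (c n) \<sigma>))" for c :: "nat \<Rightarrow> real"
  have pp: "product_prob_space (\<lambda>n::nat. density lborel (normal_density (c n) \<sigma>))" for c :: "nat \<Rightarrow> real"
    using prob_space_normal_density[OF \<sigma>] by (auto intro!: product_prob_spaceI)
  interpret A: product_prob_space "\<lambda>n. density lborel (normal_density (a n) \<sigma>)" UNIV by (rule pp)
  interpret B: product_prob_space "\<lambda>n. density lborel (normal_density (b n) \<sigma>)" UNIV by (rule pp)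
  have [measurable]: "B \<in> sets (M c)" for c using B unfolding M_def by (simp cong: sets_PiM_cong)
  have sp: "space (M c) = UNIV" for c by (simp add: M_def space_PiM)
  have eq: "emeasure (M a) B = ennreal (measure (M a) B)" "emeasure (M b) (- B) = ennreal (measure (M b) (-B))"
    unfolding M_def by (simp_all add: A.P.emeasure_eq_measure B.P.emeasure_eq_measure)
  have comp: "measure (M b) (- B) = 1 - measure (M b) B"
    using B.P.prob_compl[of B] sp[of b] \<open>\<And>c. B \<in> sets (M c)\<close>[of b] unfolding M_def by (simp add: Compl_eq_Diff_UNIV)
  have *: "(measure (M b) B)\<^sup>2 \<le> exp 1 * measure (M a) B"
    unfolding M_def by (rule gaussian_chi_square[OF assms])
  have "exp 1 * measure (M a) B \<le> 3 * measure (M a) B"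
    using exp_le by (intro mult_right_mono) auto
  then have **: "(measure (M b) B)\<^sup>2 \<le> 3 * measure (M a) B" using * by simp
  have "1/16 \<le> measure (M a) B + measure (M b) (- B)"
  proof (cases "measure (M b) B \<le> 1/2")
    case True
    then show ?thesis unfolding comp using measure_nonneg[of "M a" B] by linarith
  next
    case False
    then have "(1/2)\<^sup>2 \<le> (measure (M b) B)\<^sup>2" by (intro power_mono) auto
    then have "1/16 \<le> measure (M a) B" using ** by (simp add: power2_eq_square)
    then show ?thesis using measure_nonneg[of "M b" "-B"] by linarith
  qed
  then show ?thesis
    unfolding M_def[symmetric] eq using ennreal_leI by (simp only: ennreal_plus[symmetric] measure_nonneg)
qed

section \<open>Assouad's lemma\<close>

lemma L2_integrable_mult:
  assumes "f \<in> L2 M" "g \<in> L2 M"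
  shows "integrable M (\<lambda>x. f x * g x)"
proof -
  have [measurable]: "f \<in> borel_measurable M" "g \<in> borel_measurable M"
    and fin: "(\<integral>\<^sup>+ x. ennreal ((f x)\<^sup>2) \<partial>M) < \<infinity>" "(\<integral>\<^sup>+ x. ennreal ((g x)\<^sup>2) \<partial>M) < \<infinity>"
    using assms by (auto simp: L2_def)
  have "integrable M (\<lambda>x. (f x)\<^sup>2)" "integrable M (\<lambda>x. (g x)\<^sup>2)"
    using fin by (auto intro!: integrableI_nonneg)
  then have "integrable M (\<lambda>x. (f x)\<^sup>2 + (g x)\<^sup>2)" by simp
  then show ?thesis
  proof (rule Bochner_Integration.integrable_bound)
    have "\<bar>a * b\<bar> \<le> a\<^sup>2 + b\<^sup>2" for a b :: real
    proof -
      have "2 * \<bar>a * b\<bar> \<le> a\<^sup>2 + b\<^sup>2"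
        using sum_squares_bound[of "\<bar>a\<bar>" "\<bar>b\<bar>"] by (simp add: abs_mult mult.assoc)
      then show ?thesis using abs_ge_zero[of "a * b"] by linarith
    qed
    then show "AE x in M. norm (f x * g x) \<le> norm ((f x)\<^sup>2 + (g x)\<^sup>2)" by simp
  qed measurable
qed

lemma L2_lin:
  assumes "f \<in> L2 M" "g \<in> L2 M"
  shows "(\<lambda>x. a * f x + b * g x) \<in> L2 M"
proof -
  have [measurable]: "f \<in> borel_measurable M" "g \<in> borel_measurable M" using assms by (auto simp: L2_def)
  have "integrable M (\<lambda>x. a\<^sup>2 * (f x * f x) + 2 * a * b * (f x * g x) + b\<^sup>2 * (g x * g x))"
    using assms by (intro Bochner_Integration.integrable_add integrable_mult_right L2_integrable_mult)
  also have "(\<lambda>x. a\<^sup>2 * (f x * f x) + 2 * a * b * (f x * g x) + b\<^sup>2 * (g x * g x)) = (\<lambda>x. (a * f x + b * g x)\<^sup>2)"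
    by (auto simp: power2_eq_square algebra_simps)
  finally have "integrable M (\<lambda>x. (a * f x + b * g x)\<^sup>2)" .
  then show ?thesis by (auto simp: L2_def real_integrable_def top.not_eq_extremum)
qed

lemma L2_zero: "(\<lambda>x. 0) \<in> L2 M" by (simp add: L2_def)

lemma L2_scale: "f \<in> L2 M \<Longrightarrow> (\<lambda>x. c * f x) \<in> L2 M"
  using L2_lin[of f M f c 0] by simp

lemma L2_sum:
  assumes "finite S" "\<And>i. i \<in> S \<Longrightarrow> f i \<in> L2 M"
  shows "(\<lambda>x. \<Sum>i\<in>S. f i x) \<in> L2 M"
  using assms
proof (induction S rule: finite_induct)
  case (insert i S)
  then show ?case using L2_lin[of "f i" M "\<lambda>x. \<Sum>i\<in>S. f i x" 1 1] by simp
qed (simp add: L2_zero)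

lemma ip_sum_left:
  assumes "finite S" "\<And>i. i \<in> S \<Longrightarrow> f i \<in> L2 M" "h \<in> L2 M"
  shows "ip M (\<lambda>x. \<Sum>i\<in>S. f i x) h = (\<Sum>i\<in>S. ip M (f i) h)"
  unfolding ip_def sum_distrib_right using assms by (subst Bochner_Integration.integral_sum) (auto intro: L2_integrable_mult)

lemma ip_scale_left: "ip M (\<lambda>x. c * f x) h = c * ip M f h"
  unfolding ip_def by (simp add: mult.assoc)

lemma bessel:
  assumes S: "finite S" and b: "\<And>i. i \<in> S \<Longrightarrow> b i \<in> L2 M"
    and on: "\<And>i j. i \<in> S \<Longrightarrow> j \<in> S \<Longrightarrow> ip M (b i) (b j) = (if i = j then 1 else 0)"
    and h: "h \<in> L2 M"
  shows "(\<Sum>i\<in>S. (ip M h (b i))\<^sup>2) \<le> ip M h h"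
proof -
  define P where "P x = (\<Sum>i\<in>S. ip M h (b i) * b i x)" for x
  have P: "P \<in> L2 M" unfolding P_def using b by (intro L2_sum S L2_scale)
  have Pb: "ip M P (b j) = ip M h (b j)" if j: "j \<in> S" for j
  proof -
    have "ip M P (b j) = (\<Sum>i\<in>S. ip M h (b i) * ip M (b i) (b j))"
      unfolding P_def by (subst ip_sum_left) (auto intro: S b j L2_scale simp: ip_scale_left)
    also have "\<dots> = (\<Sum>i\<in>S. if i = j then ip M h (b i) else 0)"
      using j by (intro sum.cong) (auto simp: on)
    finally show ?thesis using S j by simp
  qed
  have comm: "ip M f g = ip M g f" for f g by (simp add: ip_def mult.commute)
  have hP: "ip M P k = (\<Sum>i\<in>S. ip M h (b i) * ip M (b i) k)" if "k \<in> L2 M" for k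
    unfolding P_def using that by (subst ip_sum_left) (auto intro: S b L2_scale simp: ip_scale_left)
  have 1: "ip M P h = (\<Sum>i\<in>S. (ip M h (b i))\<^sup>2)"
    unfolding hP[OF h] by (intro sum.cong) (auto simp: power2_eq_square comm)
  have 2: "ip M P P = (\<Sum>i\<in>S. (ip M h (b i))\<^sup>2)"
    unfolding hP[OF P] using Pb by (intro sum.cong refl) (simp add: power2_eq_square comm[of _ P])
  have "0 \<le> (\<integral>x. (h x - P x) * (h x - P x) \<partial>M)" by (intro integral_nonneg_AE) simp
  also have "\<dots> = (\<integral>x. h x * h x - 2 * (P x * h x) + P x * P x \<partial>M)"
    by (intro Bochner_Integration.integral_cong) (auto simp: algebra_simps)
  also have "\<dots> = ip M h h - 2 * ip M P h + ip M P P"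
    using h P by (simp add: ip_def L2_integrable_mult)
  finally show ?thesis unfolding 1 2 by simp
qed

text \<open>If \<open>h - f\<close> is not square integrable, the left-hand side is infinite, whatever junk value
  the Bochner integrals in \<^term>\<open>ip M h (b i)\<close> take.\<close>
lemma loss_ge_coefficients:
  assumes S: "finite S" and b: "\<And>i. i \<in> S \<Longrightarrow> b i \<in> L2 M"
    and on: "\<And>i j. i \<in> S \<Longrightarrow> j \<in> S \<Longrightarrow> ip M (b i) (b j) = (if i = j then 1 else 0)"
    and h: "h \<in> borel_measurable M" and f: "f \<in> L2 M"
  shows "(\<Sum>i\<in>S. ennreal ((ip M h (b i) - ip M f (b i))\<^sup>2)) \<le> (\<integral>\<^sup>+x. ennreal ((h x - f x)\<^sup>2) \<partial>M)"
proof (cases "(\<integral>\<^sup>+x. ennreal ((h x - f x)\<^sup>2) \<partial>M) = \<infinity>")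
  case False
  have [measurable]: "h \<in> borel_measurable M" "f \<in> borel_measurable M" using h f by (auto simp: L2_def)
  have d: "(\<lambda>x. h x - f x) \<in> L2 M" using False by (auto simp: L2_def top.not_eq_extremum)
  from L2_lin[OF d f, of 1 1] have h2: "h \<in> L2 M" by simp
  have "ip M (\<lambda>x. h x - f x) (b i) = ip M h (b i) - ip M f (b i)" if "i \<in> S" for i
    using L2_integrable_mult[OF h2 b[OF that]] L2_integrable_mult[OF f b[OF that]]
    unfolding ip_def by (simp add: left_diff_distrib)
  then have "(\<Sum>i\<in>S. ennreal ((ip M h (b i) - ip M f (b i))\<^sup>2))
     = ennreal (\<Sum>i\<in>S. (ip M (\<lambda>x. h x - f x) (b i))\<^sup>2)"
    by (simp add: sum_ennreal)
  also have "\<dots> \<le> ennreal (ip M (\<lambda>x. h x - f x) (\<lambda>x. h x - f x))"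
    by (intro ennreal_leI bessel S b on d)
  also have "\<dots> = (\<integral>\<^sup>+x. ennreal ((h x - f x)\<^sup>2) \<partial>M)"
    unfolding ip_def using L2_integrable_mult[OF d d]
    by (subst nn_integral_eq_integral[symmetric]) (auto simp: power2_eq_square)
  finally show ?thesis .
qed simp

text \<open>Summing the risk over the whole cube pairs \<open>T\<close> with \<open>insert i T\<close>, so each coordinate \<open>i\<close>
  contributes a two-point testing error.\<close>
lemma assouad:
  fixes P :: "'i set \<Rightarrow> 'w measure" and a :: "'i \<Rightarrow> 'w \<Rightarrow> real"
  assumes S: "finite S" and Ps: "\<And>T. T \<subseteq> S \<Longrightarrow> sets (P T) = sets W"
    and a [measurable]: "\<And>i. i \<in> S \<Longrightarrow> a i \<in> borel_measurable W"
    and test: "\<And>T i B. T \<subseteq> S \<Longrightarrow> i \<in> S \<Longrightarrow> i \<notin> T \<Longrightarrow> B \<in> sets W \<Longrightarrow>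
        ennreal c \<le> emeasure (P T) B + emeasure (P (insert i T)) (space W - B)"
    and c: "c \<ge> 0" and \<gamma>: "\<gamma> \<ge> 0"
    and R: "\<And>T. T \<subseteq> S \<Longrightarrow> (\<integral>\<^sup>+\<omega>. (\<Sum>i\<in>S. ennreal ((a i \<omega> - (if i \<in> T then \<gamma> else 0))\<^sup>2)) \<partial>P T) \<le> R"
  shows "ennreal (c * \<gamma>\<^sup>2 * card S / 8) \<le> R"
proof -
  define B where "B i = {\<omega>\<in>space W. a i \<omega> \<ge> \<gamma>/2}" for i
  have B [measurable]: "B i \<in> sets W" if "i \<in> S" for i unfolding B_def using that by measurable
  let ?g = "ennreal (\<gamma>\<^sup>2/4)"
  \<comment> \<open>The probability that thresholding \<open>a i\<close> at
    \<open>\<gamma>/2\<close> misjudges coordinate \<open>i\<close> when \<open>T\<close> is the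
    truth. Each misjudgement means that \<open>a i\<close> is off by at least
    \<open>\<gamma>/2\<close>, whence the price \<open>?g\<close>.\<close>
  define E where "E T i = (if i \<in> T then emeasure (P T) (space W - B i) else emeasure (P T) (B i))" for T i
  have risk: "(\<Sum>i\<in>S. ?g * E T i) \<le> R" if T: "T \<subseteq> S" for T
  proof -
    have sp: "space (P T) = space W" using Ps[OF T] by (rule sets_eq_imp_space_eq)
    have [measurable]: "a i \<in> borel_measurable (P T)" if "i \<in> S" for i
      using a[OF that] measurable_cong_sets[OF Ps[OF T] refl] by blast
    have "(\<Sum>i\<in>S. ?g * E T i) \<le> (\<Sum>i\<in>S. \<integral>\<^sup>+\<omega>. ennreal ((a i \<omega> - (if i \<in> T then \<gamma> else 0))\<^sup>2) \<partial>P T)"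
    proof (rule sum_mono)
      fix i assume i: "i \<in> S"
      define D where "D = (if i \<in> T then space W - B i else B i)"
      have D: "D \<in> sets (P T)" using B[OF i] Ps[OF T] by (auto simp: D_def)
      have "?g * E T i = (\<integral>\<^sup>+\<omega>. ?g * indicator D \<omega> \<partial>P T)"
        using D by (simp add: nn_integral_cmult_indicator E_def D_def)
      also have "\<dots> \<le> (\<integral>\<^sup>+\<omega>. ennreal ((a i \<omega> - (if i \<in> T then \<gamma> else 0))\<^sup>2) \<partial>P T)"
      proof (rule nn_integral_mono)
        fix \<omega> assume "\<omega> \<in> space (P T)"
        have "\<gamma>\<^sup>2/4 \<le> (a i \<omega> - (if i \<in> T then \<gamma> else 0))\<^sup>2" if w: "\<omega> \<in> D"
        proof -
          have "\<gamma>/2 \<le> \<bar>a i \<omega> - (if i \<in> T then \<gamma> else 0)\<bar>"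
            using w \<gamma> by (auto simp: D_def B_def split: if_splits)
          then have "(\<gamma>/2)\<^sup>2 \<le> \<bar>a i \<omega> - (if i \<in> T then \<gamma> else 0)\<bar>\<^sup>2"
            using \<gamma> by (intro power_mono) auto
          then show ?thesis by (simp add: power_divide)
        qed
        then show "?g * indicator D \<omega> \<le> ennreal ((a i \<omega> - (if i \<in> T then \<gamma> else 0))\<^sup>2)"
          by (auto simp: indicator_def intro!: ennreal_leI)
      qed
      finally show "?g * E T i \<le> (\<integral>\<^sup>+\<omega>. ennreal ((a i \<omega> - (if i \<in> T then \<gamma> else 0))\<^sup>2) \<partial>P T)" .
    qed
    also have "\<dots> = (\<integral>\<^sup>+\<omega>. (\<Sum>i\<in>S. ennreal ((a i \<omega> - (if i \<in> T then \<gamma> else 0))\<^sup>2)) \<partial>P T)"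
      by (subst nn_integral_sum) auto
    also have "\<dots> \<le> R" by (rule R[OF T])
    finally show ?thesis .
  qed
  have pair: "ennreal (c * 2 ^ (card S - 1)) \<le> (\<Sum>T\<in>Pow S. E T i)" if i: "i \<in> S" for i
  proof -
    let ?S = "S - {i}"
    have PS: "Pow S = Pow ?S \<union> insert i ` Pow ?S" using i Pow_insert[of i ?S] by (simp add: insert_absorb)
    have "ennreal (c * 2 ^ (card S - 1)) = (\<Sum>T\<in>Pow ?S. ennreal c)"
      using i S c by (simp add: card_Pow ennreal_mult' mult.commute ennreal_power flip: ennreal_numeral)
    also have "\<dots> \<le> (\<Sum>T\<in>Pow ?S. E T i + E (insert i T) i)"
    proof (rule sum_mono)
      fix T assume "T \<in> Pow ?S"
      then show "ennreal c \<le> E T i + E (insert i T) i"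
        using test[of T i "B i"] i B by (auto simp: E_def)
    qed
    also have "\<dots> = (\<Sum>T\<in>Pow ?S. E T i) + (\<Sum>T\<in>insert i ` Pow ?S. E T i)"
      by (subst sum.reindex) (auto simp: sum.distrib inj_on_def)
    also have "\<dots> = (\<Sum>T\<in>Pow S. E T i)"
      unfolding PS using S by (subst sum.union_disjoint) auto
    finally show ?thesis .
  qed
  show ?thesis
  proof (cases "S = {}")
    case False
    have cS: "card S > 0" using False S by (simp add: card_gt_0_iff)
    \<comment> \<open>The 8 is 4 * 2: the squared half-gap contributes 1/4, and each coordinate has
      \<open>2 ^ (card S - 1)\<close> neighbouring pairs for \<open>2 ^ card S\<close>
      vertices.\<close>
    have "ennreal (2 ^ card S) * ennreal (c * \<gamma>\<^sup>2 * card S / 8)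
       = (\<Sum>i\<in>S. ?g * ennreal (c * 2 ^ (card S - 1)))"
    proof -
      have "2 ^ card S * (c * \<gamma>\<^sup>2 * card S / 8) = card S * (\<gamma>\<^sup>2/4 * (c * 2 ^ (card S - 1)))"
        using cS by (cases "card S") auto
      then show ?thesis using c
        by (simp add: ennreal_of_nat_eq_real_of_nat flip: ennreal_mult')
    qed
    also have "\<dots> \<le> (\<Sum>i\<in>S. ?g * (\<Sum>T\<in>Pow S. E T i))"
      by (intro sum_mono mult_left_mono pair) auto
    also have "\<dots> = (\<Sum>T\<in>Pow S. \<Sum>i\<in>S. ?g * E T i)"
      unfolding sum_distrib_left by (rule sum.swap)
    also have "\<dots> \<le> (\<Sum>T\<in>Pow S. R)" by (intro sum_mono risk) auto
    also have "\<dots> = ennreal (2 ^ card S) * R" using S by (simp add: card_Pow ennreal_power flip: ennreal_numeral)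
    finally show ?thesis by (subst (asm) ennreal_mult_le_mult_iff) auto
  qed simp
qed

section \<open>Uniqueness of Fourier coefficients\<close>

lemma I01_simps [simp]: "space I01 = {0..1}" "finite_measure I01"
  by (auto simp: I01_def space_restrict_space intro!: finite_measureI simp: emeasure_restrict_space)

interpretation I01: finite_measure I01 by simp

lemma measurable_cis_mult [measurable]: "(\<lambda>t. cis (c * t)) \<in> borel_measurable I01"
  unfolding I01_def
  by (intro measurable_restrict_space1 measurable_lborel2[THEN equalityD2, THEN subsetD]
      borel_measurable_continuous_onI continuous_intros)

lemma measurable_I01: "f \<in> borel_measurable borel \<Longrightarrow> f \<in> borel_measurable I01"
  unfolding I01_def by (intro measurable_restrict_space1) simp

lemma integrable_I01_bounded_mult:
  fixes k f :: "real \<Rightarrow> complex"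
  assumes "integrable I01 k" "f \<in> borel_measurable I01" "\<And>t. t \<in> {0..1} \<Longrightarrow> norm (f t) \<le> C"
  shows "integrable I01 (\<lambda>t. k t * f t)"
proof (rule Bochner_Integration.integrable_bound)
  show "integrable I01 (\<lambda>t. C *\<^sub>R k t)" using assms(1) by simp
  show "(\<lambda>t. k t * f t) \<in> borel_measurable I01" using assms by measurable
  show "AE t in I01. norm (k t * f t) \<le> norm (C *\<^sub>R k t)"
  proof (rule AE_I2)
    fix t assume "t \<in> space I01"
    then have "norm (f t) \<le> C" using assms(3) by simp
    moreover then have "0 \<le> C" using norm_ge_zero[of "f t"] by linarith
    ultimately show "norm (k t * f t) \<le> norm (C *\<^sub>R k t)"
      by (simp add: norm_mult mult.commute mult_right_mono)
  qed
qed

text \<open>Complex-valued, so that the class is closed under multiplication by exponentials; the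
  passage to trigonometric polynomials, continuous functions and arcs depends on that
  closure.\<close>

definition fourier_null :: "(real \<Rightarrow> complex) \<Rightarrow> bool" where
  "fourier_null k \<longleftrightarrow> integrable I01 k \<and> (\<forall>m::int. (\<integral>t. k t * cis (2 * pi * real_of_int m * t) \<partial>I01) = 0)"

lemma fourier_null_integrable_cis:
  "fourier_null k \<Longrightarrow> integrable I01 (\<lambda>t. k t * cis (2 * pi * real_of_int m * t))"
  unfolding fourier_null_def by (rule integrable_I01_bounded_mult[where C = 1]) auto

lemma fourier_null_cis_mult:
  assumes "fourier_null k"
  shows "fourier_null (\<lambda>t. k t * cis (2 * pi * real_of_int n * t))"
proof -
  have "(\<lambda>t. k t * cis (2 * pi * real_of_int n * t) * cis (2 * pi * real_of_int m * t))
     = (\<lambda>t. k t * cis (2 * pi * real_of_int (n + m) * t))" for m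
    by (simp add: mult.assoc cis_mult algebra_simps)
  then show ?thesis
    using assms fourier_null_integrable_cis[OF assms] unfolding fourier_null_def by (simp del: of_int_add)
qed

lemma fourier_null_add:
  assumes "fourier_null k" "fourier_null l"
  shows "fourier_null (\<lambda>t. k t + l t)"
  using assms fourier_null_integrable_cis[OF assms(1)] fourier_null_integrable_cis[OF assms(2)]
  by (auto simp: fourier_null_def distrib_right)

lemma fourier_null_scale: "fourier_null k \<Longrightarrow> fourier_null (\<lambda>t. c * k t)"
  by (auto simp: fourier_null_def mult.assoc)

text \<open>Multiplication by \<open>z\<close> or its conjugate only shifts the Fourier coefficients.\<close>
lemma fourier_null_polynomial:
  assumes "real_polynomial_function p" "fourier_null k"
  shows "fourier_null (\<lambda>t. k t * of_real (p (cis (2 * pi * t))))"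
  using assms
proof (induction arbitrary: k rule: real_polynomial_function.induct)
  case (linear f)
  interpret f: bounded_linear f by fact
  \<comment> \<open>A real-linear functional is a combination of real and imaginary part, hence of
    \<open>z\<close> and \<open>cnj z\<close>, which on the circle are the exponentials of frequency
    1 and -1.\<close>
  have eq: "of_real (f z) = of_real (f 1) * ((z + cnj z) / 2) + of_real (f \<i>) * ((z - cnj z) / (2 * \<i>))" for z
  proof -
    have "f z = f (Re z *\<^sub>R 1 + Im z *\<^sub>R \<i>)" by (simp add: complex_eq[of z, symmetric] scaleR_conv_of_real mult.commute)
    also have "\<dots> = Re z * f 1 + Im z * f \<i>" by (simp add: f.add f.scaleR)
    finally show ?thesis by (simp add: complex_add_cnj complex_diff_cnj field_simps)
  qed
  define A where "A = (of_real (f 1) / 2 + of_real (f \<i>) / (2 * \<i>) :: complex)"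
  define B where "B = (of_real (f 1) / 2 - of_real (f \<i>) / (2 * \<i>) :: complex)"
  have "k t * of_real (f (cis (2 * pi * t))) = A * (k t * cis (2 * pi * real_of_int 1 * t))
     + B * (k t * cis (2 * pi * real_of_int (-1) * t))" for t
    by (subst eq) (simp add: A_def B_def cis_cnj field_simps)
  then show ?case
    by (simp only:) (intro fourier_null_add fourier_null_scale fourier_null_cis_mult linear.prems)
next
  case (const c)
  then show ?case using fourier_null_scale[of k "of_real c"] by (simp add: mult.commute)
next
  case (add f g)
  then show ?case using fourier_null_add[OF add.IH(1) add.IH(2)] by (simp add: distrib_left)
next
  case (mult f g)
  then show ?case using mult.IH(2)[OF mult.IH(1)] by (simp add: mult.assoc)
qed

text \<open>Passing to the circle makes the periodic functions continuous functions on a compact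
  set, where Stone-Weierstrass supplies uniformly close real polynomials; those integrate to 0
  against \<open>k\<close>.\<close>

lemma fourier_null_continuous:
  fixes F :: "complex \<Rightarrow> real"
  assumes k: "fourier_null k" and F: "continuous_on UNIV F"
  shows "(\<integral>t. k t * of_real (F (cis (2 * pi * t))) \<partial>I01) = 0"
proof -
  have ki: "integrable I01 k" using k by (simp add: fourier_null_def)
  define K where "K = (\<integral>t. norm (k t) \<partial>I01)"
  have K: "K \<ge> 0" unfolding K_def by simp
  have cs: "compact (sphere 0 1 :: complex set)" by simp
  have "continuous_on (sphere 0 1) F" using F continuous_on_subset by blast
  have cisc: "continuous_on UNIV (\<lambda>t. cis (2 * pi * t))" by (intro continuous_intros)
  have int: "integrable I01 (\<lambda>t. k t * of_real (G (cis (2 * pi * t))))"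
    if G: "continuous_on UNIV G" for G :: "complex \<Rightarrow> real"
  proof -
    have "bounded (G ` sphere 0 1)"
      using cs G by (intro compact_imp_bounded compact_continuous_image) (auto intro: continuous_on_subset)
    then obtain C where C: "\<And>z. z \<in> sphere 0 1 \<Longrightarrow> \<bar>G z\<bar> \<le> C"
      unfolding bounded_iff real_norm_def by (metis imageI)
    have "(\<lambda>t. G (cis (2 * pi * t))) \<in> borel_measurable borel"
      by (intro borel_measurable_continuous_onI continuous_on_compose2[OF G cisc]) auto
    then show ?thesis
      using C by (intro integrable_I01_bounded_mult[OF ki, where C = C] measurable_I01) auto
  qed
  have "norm (\<integral>t. k t * of_real (F (cis (2 * pi * t))) \<partial>I01) \<le> 0 + e" if e: "e > 0" for e
  proof -
    \<comment> \<open>The \<open>+ 1\<close> covers the case \<open>K = 0\<close>.\<close>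
    define d where "d = e / (K + 1)"
    have d: "d > 0" using K e by (simp add: d_def)
    obtain p where p: "real_polynomial_function p" "\<And>z. z \<in> sphere 0 1 \<Longrightarrow> \<bar>F z - p z\<bar> < d"
      using Stone_Weierstrass_real_polynomial_function[OF cs \<open>continuous_on (sphere 0 1) F\<close> d] by metis
    have pc: "continuous_on UNIV p"
      using p(1) by (simp add: continuous_on_polymonial_function real_polynomial_function_eq)
    have "(\<integral>t. k t * of_real (p (cis (2 * pi * t))) \<partial>I01) = 0"
      using fourier_null_polynomial[OF p(1) k] unfolding fourier_null_def by (auto dest!: spec[of _ 0])
    then have "(\<integral>t. k t * of_real (F (cis (2 * pi * t))) \<partial>I01)
       = (\<integral>t. k t * of_real (F (cis (2 * pi * t))) - k t * of_real (p (cis (2 * pi * t))) \<partial>I01)"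
      by (subst Bochner_Integration.integral_diff[OF int[OF F] int[OF pc]]) simp
    also have "norm \<dots> \<le> (\<integral>t. d * norm (k t) \<partial>I01)"
    proof (rule order_trans[OF integral_norm_bound integral_mono])
      show "integrable I01 (\<lambda>t. norm (k t * of_real (F (cis (2 * pi * t))) - k t * of_real (p (cis (2 * pi * t)))))"
        by (intro integrable_norm Bochner_Integration.integrable_diff int F pc)
      show "integrable I01 (\<lambda>t. d * norm (k t))" using ki by simp
      fix t
      have "norm (k t * of_real (F (cis (2 * pi * t))) - k t * of_real (p (cis (2 * pi * t))))
         = norm (k t) * \<bar>F (cis (2 * pi * t)) - p (cis (2 * pi * t))\<bar>"
        by (metis norm_mult norm_of_real of_real_diff right_diff_distrib)
      also have "\<dots> \<le> norm (k t) * d"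
        using p(2)[of "cis (2 * pi * t)"] by (intro mult_left_mono) auto
      finally show "norm (k t * of_real (F (cis (2 * pi * t))) - k t * of_real (p (cis (2 * pi * t))))
        \<le> d * norm (k t)" by (simp add: mult.commute)
    qed
    also have "\<dots> = d * K" by (simp add: K_def)
    also have "\<dots> \<le> e" using K e by (simp add: d_def field_simps)
    finally show ?thesis by simp
  qed
  then have "norm (\<integral>t. k t * of_real (F (cis (2 * pi * t))) \<partial>I01) \<le> 0" by (rule field_le_epsilon)
  then show ?thesis by simp
qed

text \<open>The indicator of a closed set is the decreasing limit of the tent functions
  \<open>max 0 (1 - real n * infdist z K)\<close>, and \<open>norm (k t)\<close> dominates. The set
  must be nonempty for this construction because \<open>infdist\<close> to the empty set is 0 by
  convention, which would make every tent constantly 1.\<close>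

lemma fourier_null_closed:
  fixes K :: "complex set"
  assumes k: "fourier_null k" and K: "closed K" "K \<noteq> {}"
  shows "(\<integral>t. k t * indicator K (cis (2 * pi * t)) \<partial>I01) = 0"
proof -
  have ki: "integrable I01 k" using k by (simp add: fourier_null_def)
  have [measurable]: "k \<in> borel_measurable I01" using ki by simp
  define F where "F n z = max 0 (1 - real n * infdist z K)" for n z
  have Fc: "continuous_on UNIV (F n)" for n
    unfolding F_def by (intro continuous_intros)
  have cisc: "continuous_on UNIV (\<lambda>t. cis (2 * pi * t))" by (intro continuous_intros)
  have cism [measurable]: "(\<lambda>t. cis (2 * pi * t)) \<in> measurable I01 borel"
    by (intro measurable_I01 borel_measurable_continuous_onI cisc)
  have [measurable]: "F n \<in> borel_measurable borel" for n
    by (intro borel_measurable_continuous_onI Fc)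
  have [measurable]: "K \<in> sets borel" using K by simp
  have lim: "(\<lambda>n. F n z) \<longlonglongrightarrow> indicator K z" for z
  proof (cases "z \<in> K")
    case True
    then show ?thesis by (simp add: F_def)
  next
    case False
    then have "infdist z K > 0" using K infdist_pos_not_in_closed by metis
    then have "eventually (\<lambda>n. F n z = 0) sequentially"
    proof -
      obtain N where N: "real N * infdist z K > 1" using \<open>infdist z K > 0\<close> reals_Archimedean3 by blast
      have "F n z = 0" if "n \<ge> N" for n
      proof -
        have "real N * infdist z K \<le> real n * infdist z K"
          using that \<open>infdist z K > 0\<close> by (intro mult_right_mono) auto
        then show ?thesis using N by (simp add: F_def)
      qed
      then show ?thesis by (auto simp: eventually_sequentially)
    qed
    then show ?thesis using False by (simp add: tendsto_eventually)
  qed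
  have "(\<lambda>n. \<integral>t. k t * of_real (F n (cis (2 * pi * t))) \<partial>I01)
     \<longlonglongrightarrow> (\<integral>t. k t * of_real (indicator K (cis (2 * pi * t))) \<partial>I01)"
  proof (rule integral_dominated_convergence[where w = "\<lambda>t. norm (k t)"])
    show "integrable I01 (\<lambda>t. norm (k t))" using ki by simp
    show "AE t in I01. (\<lambda>n. k t * of_real (F n (cis (2 * pi * t)))) \<longlonglongrightarrow> k t * of_real (indicator K (cis (2 * pi * t)))"
      by (intro AE_I2 tendsto_intros lim)
    show "AE t in I01. norm (k t * of_real (F n (cis (2 * pi * t)))) \<le> norm (k t)" for n
      by (intro AE_I2) (auto simp: norm_mult F_def infdist_nonneg intro!: mult_left_le)
  qed measurable
  then have "(\<integral>t. k t * of_real (indicator K (cis (2 * pi * t))) \<partial>I01) = 0"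
    using fourier_null_continuous[OF k Fc] by (simp add: LIMSEQ_const_iff)
  then show ?thesis by (simp add: of_real_indicator)
qed

text \<open>For \<open>0 \<le> a < 1\<close> the interval from 0 to \<open>a\<close> is the preimage
  of a closed arc of the circle, up to the point 1.\<close>

lemma fourier_null_atMost:
  assumes k: "fourier_null k"
  shows "(\<integral>t. indicator {..a} t *\<^sub>R k t \<partial>I01) = 0"
proof -
  consider "a < 0" | "0 \<le> a" "a < 1" | "1 \<le> a" by linarith
  then show ?thesis
  proof cases
    case 1
    have "(\<integral>t. indicator {..a} t *\<^sub>R k t \<partial>I01) = (\<integral>t. 0 \<partial>I01)"
      using 1 by (intro Bochner_Integration.integral_cong) (auto simp: indicator_def)
    then show ?thesis by simp
  next
    case 3
    have "(\<integral>t. indicator {..a} t *\<^sub>R k t \<partial>I01) = (\<integral>t. k t \<partial>I01)"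
      using 3 by (intro Bochner_Integration.integral_cong) (auto simp: indicator_def)
    then show ?thesis using k by (auto simp: fourier_null_def dest!: spec[of _ 0])
  next
    case 2
    let ?K = "(\<lambda>t. cis (2 * pi * t)) ` {0..a}"
    have "compact ?K" by (intro compact_continuous_image continuous_intros) auto
    then have K: "closed ?K" "?K \<noteq> {}" using 2 by (auto intro: compact_imp_closed)
    have [measurable]: "?K \<in> sets borel" using K by simp
    have [measurable]: "k \<in> borel_measurable I01" using k by (auto simp: fourier_null_def)
    have [measurable]: "(\<lambda>t. cis (2 * pi * t)) \<in> measurable I01 borel"
      by (intro measurable_I01 borel_measurable_continuous_onI continuous_intros)
    have [measurable]: "(\<lambda>t. indicator {..a} t :: real) \<in> borel_measurable I01"
      by (intro measurable_I01) simp
    have eq: "cis (2 * pi * t) \<in> ?K \<longleftrightarrow> t \<le> a" if "0 \<le> t" "t < 1" for t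
    proof
      assume "cis (2 * pi * t) \<in> ?K"
      then obtain s where s: "0 \<le> s" "s \<le> a" "cis (2 * pi * t) = cis (2 * pi * s)" by auto
      then have "sin (2 * pi * t) = sin (2 * pi * s) \<and> cos (2 * pi * t) = cos (2 * pi * s)"
        by (metis cis.sel)
      then obtain n :: int where "2 * pi * t = 2 * pi * s + 2 * pi * n"
        using sin_cos_eq_iff by metis
      then have "2 * pi * t = 2 * pi * (s + n)" by (simp add: algebra_simps)
      then have n: "t = s + n" by simp
      have "n = 0" using n s that 2 by linarith
      then show "t \<le> a" using n s by simp
    qed (use that in auto)
    \<comment> \<open>The endpoint \<open>t = 1\<close> has the same image as \<open>t = 0\<close>
      and so lies in the arc without satisfying \<open>t \<le> a\<close>; it is a null set.\<close>
    have "AE t in I01. t \<noteq> 1"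
      unfolding I01_def by (subst AE_restrict_space_iff) (auto intro: AE_mp[OF AE_lborel_singleton[of 1]])
    then have "(\<integral>t. indicator {..a} t *\<^sub>R k t \<partial>I01) = (\<integral>t. k t * indicator ?K (cis (2 * pi * t)) \<partial>I01)"
    proof (intro integral_cong_AE)
      assume "AE t in I01. t \<noteq> 1"
      with AE_space show "AE t in I01. indicator {..a} t *\<^sub>R k t = k t * indicator ?K (cis (2 * pi * t))"
      proof eventually_elim
        case (elim t)
        then have "indicator ?K (cis (2 * pi * t)) = (indicator {..a} t :: complex)"
          using eq[of t] by (simp add: indicator_def)
        then show ?case by (simp add: indicator_def)
      qed
    qed measurable
    then show ?thesis using fourier_null_closed[OF k K] by simp
  qed
qed

text \<open>Half-lines form an intersection-stable generator of the Borel sets, so the vanishing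
  integrals over them spread to all Borel sets by Dynkin's argument, and an integrable function with
  this property is 0 a.e.\<close>

lemma fourier_null_AE:
  assumes k: "fourier_null k"
  shows "AE t in I01. k t = 0"
proof -
  define h where "h t = indicator {0..1} t *\<^sub>R k t" for t :: real
  have ki: "integrable I01 k" using k by (simp add: fourier_null_def)
  then have hi: "integrable lborel h"
    unfolding h_def I01_def by (subst (asm) integrable_restrict_space) auto
  have base: "(\<integral>t. indicator {..a} t *\<^sub>R h t \<partial>lborel) = 0" for a
    using fourier_null_atMost[OF k, of a] unfolding I01_def h_def
    by (subst (asm) integral_restrict_space) (auto simp: mult.commute)
  have all: "(\<integral>t. h t \<partial>lborel) = 0"
  proof -
    have "(\<lambda>t. indicator {..1} t *\<^sub>R h t) = h" by (auto simp: h_def indicator_def)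
    then show ?thesis using base[of 1] by simp
  qed
  have int: "integrable lborel (\<lambda>t. indicator A t *\<^sub>R h t)" if "A \<in> sets borel" for A
    using that hi by (intro integrable_mult_indicator) auto
  have "AE t in lborel. h t = 0"
  proof (rule sigma_finite_measure.density_zero[OF sigma_finite_lborel hi])
    fix A :: "real set" assume "A \<in> sets lborel"
    then have A: "A \<in> sigma_sets UNIV (range atMost)" by (simp add: borel_eq_atMost)
    have "Int_stable (range atMost :: real set set)"
      by (auto simp: Int_stable_def)
    from this subset_UNIV[THEN Pow_UNIV[THEN equalityD2, THEN subset_trans[rotated]]] A
    have "(\<integral>t. indicator A t *\<^sub>R h t \<partial>lborel) = 0"
    proof (induction rule: sigma_sets_induct_disjoint)
      case (basic A)
      then show ?case using base by auto
    next
      case empty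
      then show ?case by simp
    next
      case (compl A)
      then have A: "A \<in> sets borel" by (simp add: borel_eq_atMost)
      have "(\<integral>t. indicator (UNIV - A) t *\<^sub>R h t \<partial>lborel)
         = (\<integral>t. h t - indicator A t *\<^sub>R h t \<partial>lborel)"
        by (intro Bochner_Integration.integral_cong) (auto simp: indicator_def)
      also have "\<dots> = 0" using compl all
        by (subst Bochner_Integration.integral_diff[OF hi int[OF A]]) auto
      finally show ?case .
    next
      case (union A)
      then have A: "A i \<in> sets borel" for i by (auto simp: borel_eq_atMost)
      have "(LINT t:(\<Union>i. A i)|lborel. h t) = (\<Sum>i. (LINT t:(A i)|lborel. h t))"
        using A union(1) int
        by (intro lebesgue_integral_countable_add) (auto simp: disjoint_family_on_def set_integrable_def)
      then show ?case using union by (simp add: set_lebesgue_integral_def)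
    qed
    then show "set_lebesgue_integral lborel A h = 0" by (simp add: set_lebesgue_integral_def)
  qed
  then show ?thesis
    unfolding I01_def by (subst AE_restrict_space_iff) (auto simp: h_def elim!: eventually_mono)
qed

section \<open>Convolution with a band-limited function\<close>

text \<open>By periodicity \<open>t\<close> may be replaced by its fractional part \<open>f\<close>.
  Reflection \<open>x\<close> to \<open>f - x\<close> maps the interval from 0 to \<open>f\<close>
  onto itself, and \<open>x\<close> to \<open>1 + f - x\<close> does the same for the interval from
  \<open>f\<close> to 1; the two pieces are treated separately and added.\<close>

lemma has_bochner_integral_periodic:
  fixes k :: "real \<Rightarrow> complex"
  assumes per: "\<And>x. k (x + 1) = k x" and k: "integrable I01 k"
    and [measurable]: "k \<in> borel_measurable borel"
  shows "has_bochner_integral I01 (\<lambda>x. k (t - x)) (\<integral>x. k x \<partial>I01)"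
proof -
  define f where "f = frac t"
  have f: "0 \<le> f" "f < 1" by (auto simp: f_def frac_lt_1)
  have pern: "k (x + real n) = k x" for x n
    by (induction n) (use per[of "x + real _"] in \<open>auto simp: add.commute add.left_commute\<close>)
  have peri: "k (x + of_int n) = k x" for x n
  proof (cases "n \<ge> 0")
    case True
    then show ?thesis using pern[of x "nat n"] by simp
  next
    case False
    then show ?thesis using pern[of "x + of_int n" "nat (- n)"] by simp
  qed
  have tf: "k (t - x) = k (f - x)" for x
    using peri[of "f - x" "\<lfloor>t\<rfloor>"] by (simp add: f_def frac_def)
  define h where "h t = indicator {0..1} t *\<^sub>R k t" for t :: real
  have hi: "integrable lborel h"
    using k unfolding h_def I01_def by (subst (asm) integrable_restrict_space) auto
  have kint: "(\<integral>x. k x \<partial>I01) = (\<integral>x. h x \<partial>lborel)"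
    unfolding h_def I01_def by (subst integral_restrict_space) auto
  let ?A = "\<lambda>x. indicator {0..f} x *\<^sub>R h x" and ?B = "\<lambda>x. indicator {f<..<1} x *\<^sub>R h x"
  have iA: "integrable lborel ?A" and iB: "integrable lborel ?B"
    using hi by (auto intro: integrable_mult_indicator)
  have "(\<integral>x. ?A x \<partial>lborel) + (\<integral>x. ?B x \<partial>lborel) = (\<integral>x. ?A x + ?B x \<partial>lborel)"
    using iA iB by simp
  also have "\<dots> = (\<integral>x. h x \<partial>lborel)"
  proof (rule integral_cong_AE)
    show "AE x in lborel. ?A x + ?B x = h x"
      using AE_lborel_singleton[of 1] by eventually_elim (use f in \<open>auto simp: h_def indicator_def\<close>)
  qed (use hi iA iB in auto)
  finally have sum: "(\<integral>x. ?A x \<partial>lborel) + (\<integral>x. ?B x \<partial>lborel) = (\<integral>x. h x \<partial>lborel)" .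
  have A: "has_bochner_integral lborel (\<lambda>x. ?A (f + (-1) * x)) (\<integral>x. ?A x \<partial>lborel)"
    using lborel_integrable_real_affine[OF iA, of "-1" f] lborel_integral_real_affine[of "-1" ?A f]
    by (simp add: has_bochner_integral_iff)
  have B: "has_bochner_integral lborel (\<lambda>x. ?B ((1 + f) + (-1) * x)) (\<integral>x. ?B x \<partial>lborel)"
    using lborel_integrable_real_affine[OF iB, of "-1" "1 + f"] lborel_integral_real_affine[of "-1" ?B "1 + f"]
    by (simp add: has_bochner_integral_iff)
  have AB: "has_bochner_integral lborel (\<lambda>x. ?A (f + (-1) * x) + ?B ((1 + f) + (-1) * x)) (\<integral>x. h x \<partial>lborel)"
    using has_bochner_integral_add[OF A B] unfolding sum .
  have eq: "?A (f + (-1) * x) + ?B ((1 + f) + (-1) * x) = indicator {0..<1} x *\<^sub>R k (t - x)"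
    if "x \<noteq> 1" for x
    using f that per[of "f - x"] unfolding tf h_def indicator_def by (auto simp: algebra_simps)
  have meas: "(\<lambda>x. indicator {0..1} x *\<^sub>R k (t - x)) \<in> borel_measurable lborel"
    by measurable
  have "has_bochner_integral lborel (\<lambda>x. indicator {0..1} x *\<^sub>R k (t - x)) (\<integral>x. h x \<partial>lborel)"
  proof (rule has_bochner_integral_cong_AE[THEN iffD1, OF _ _ _ AB])
    show "AE x in lborel. ?A (f + (-1) * x) + ?B ((1 + f) + (-1) * x) = indicator {0..1} x *\<^sub>R k (t - x)"
      using AE_lborel_singleton[of 1] by eventually_elim (subst eq, auto simp: indicator_def)
  qed (use AB meas in \<open>auto simp: has_bochner_integral_iff\<close>)
  then show ?thesis
    unfolding kint unfolding I01_def by (subst has_bochner_integral_restrict_space) auto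
qed

lemma integral_cis_int: "(\<integral>t. cis (2 * pi * real_of_int m * t) \<partial>I01) = (if m = 0 then 1 else 0)"
proof (cases "m = 0")
  case True
  have "measure I01 {0..1} = 1" by (simp add: I01_def measure_restrict_space)
  then show ?thesis using True by simp
next
  case False
  let ?k = "\<lambda>t. cis (2 * pi * real_of_int m * t)"
  have i: "integrable I01 ?k" by (intro I01.integrable_const_bound[where B = 1]) auto
  have per: "?k (x + 1) = ?k x" for x
    using cis_mult[of "2 * pi * real_of_int m * x" "2 * pi * real_of_int m"]
    by (simp add: distrib_left)
  have bm: "?k \<in> borel_measurable borel" by (intro borel_measurable_continuous_onI continuous_intros)
  have J: "(\<integral>x. ?k (t - x) \<partial>I01) = (\<integral>x. ?k x \<partial>I01)" for t
    using has_bochner_integral_periodic[OF per i bm] by (rule has_bochner_integral_integral_eq)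
  \<comment> \<open>Shifting by half a period changes the sign but not the integral.\<close>
  have "(\<integral>x. ?k (1 / (2 * real_of_int m) - x) \<partial>I01) = (\<integral>x. - ?k (0 - x) \<partial>I01)"
  proof (rule Bochner_Integration.integral_cong[OF refl])
    fix x
    have "2 * pi * real_of_int m * (1 / (2 * real_of_int m) - x) = pi + 2 * pi * real_of_int m * (0 - x)"
      using False by (simp add: field_simps)
    then show "?k (1 / (2 * real_of_int m) - x) = - ?k (0 - x)"
      by (simp only: cis_mult[symmetric] cis_pi) simp
  qed
  also have "\<dots> = - (\<integral>x. ?k (0 - x) \<partial>I01)" by simp
  finally show ?thesis unfolding J using False by simp
qed

lemma integrable_cis: "integrable I01 (\<lambda>t. cis (c * t))"
  by (intro I01.integrable_const_bound[where B = 1]) auto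

lemma has_bochner_integral_cis_int:
  "has_bochner_integral I01 (\<lambda>t. cis (2 * pi * real_of_int m * t)) (if m = 0 then 1 else 0)"
  using integrable_cis integral_cis_int by (simp add: has_bochner_integral_iff)

lemma trig_parseval:
  assumes "finite F"
  shows "has_bochner_integral I01 (\<lambda>t. (cmod (\<Sum>m\<in>F. a m * cis (2 * pi * real_of_int m * t)))\<^sup>2)
    (\<Sum>m\<in>F. (cmod (a m))\<^sup>2)"
proof -
  have eq: "of_real ((cmod (\<Sum>m\<in>F. a m * cis (2 * pi * real_of_int m * t)))\<^sup>2)
     = (\<Sum>m\<in>F. \<Sum>n\<in>F. a m * cnj (a n) * cis (2 * pi * real_of_int (m - n) * t))" for t
  proof -
    have "of_real ((cmod (\<Sum>m\<in>F. a m * cis (2 * pi * real_of_int m * t)))\<^sup>2)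
     = (\<Sum>m\<in>F. a m * cis (2 * pi * real_of_int m * t)) * (\<Sum>n\<in>F. cnj (a n) * cis (- (2 * pi * real_of_int n * t)))"
      by (simp only: complex_norm_square cnj_sum complex_cnj_mult cis_cnj)
    also have "\<dots> = (\<Sum>m\<in>F. \<Sum>n\<in>F. a m * cnj (a n) * (cis (2 * pi * real_of_int m * t) * cis (- (2 * pi * real_of_int n * t))))"
      by (simp add: sum_product mult_ac)
    finally show ?thesis by (simp add: cis_mult algebra_simps)
  qed
  have "has_bochner_integral I01 (\<lambda>t. \<Sum>m\<in>F. \<Sum>n\<in>F. a m * cnj (a n) * cis (2 * pi * real_of_int (m - n) * t))
     (\<Sum>m\<in>F. \<Sum>n\<in>F. a m * cnj (a n) * (if m - n = 0 then 1 else 0))"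
    by (intro has_bochner_integral_sum has_bochner_integral_mult_right has_bochner_integral_cis_int)
  also have "(\<Sum>m\<in>F. \<Sum>n\<in>F. a m * cnj (a n) * (if m - n = 0 then 1 else 0)) = of_real (\<Sum>m\<in>F. (cmod (a m))\<^sup>2)"
    using assms by (simp add: complex_norm_square[symmetric] if_distrib cong: if_cong del: of_real_power)
  finally have *: "has_bochner_integral I01 (\<lambda>t. of_real ((cmod (\<Sum>m\<in>F. a m * cis (2 * pi * real_of_int m * t)))\<^sup>2) :: complex)
     (of_real (\<Sum>m\<in>F. (cmod (a m))\<^sup>2))" unfolding eq .
  from has_bochner_integral_Re[OF this] show ?thesis by simp
qed

text \<open>A band limit is a statement about vanishing coefficients. Uniqueness, applied to the
  difference between \<open>h\<close> and its Fourier sum, turns it into an explicit trigonometric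
  polynomial.\<close>

lemma trig_representation:
  assumes h: "integrable I01 h" and F: "finite F" "\<And>m. m \<notin> F \<Longrightarrow> fourier_coeff h m = 0"
  shows "AE t in I01. complex_of_real (h t) = (\<Sum>m\<in>F. fourier_coeff h m * cis (2 * pi * real_of_int m * t))"
proof -
  let ?T = "\<lambda>t. \<Sum>m\<in>F. fourier_coeff h m * cis (2 * pi * real_of_int m * t)"
  have hc: "integrable I01 (\<lambda>t. complex_of_real (h t))" using h by simp
  have T: "integrable I01 ?T" by (intro Bochner_Integration.integrable_sum integrable_mult_right integrable_cis)
  have "fourier_null (\<lambda>t. complex_of_real (h t) - ?T t)"
    unfolding fourier_null_def
  proof (intro conjI allI)
    show "integrable I01 (\<lambda>t. complex_of_real (h t) - ?T t)"
      using hc T by (rule Bochner_Integration.integrable_diff)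
    fix n :: int
    have "(\<integral>t. (complex_of_real (h t) - ?T t) * cis (2 * pi * real_of_int n * t) \<partial>I01)
       = (\<integral>t. complex_of_real (h t) * cis (2 * pi * real_of_int n * t)
           - (\<Sum>m\<in>F. fourier_coeff h m * cis (2 * pi * real_of_int (m + n) * t)) \<partial>I01)"
      by (intro Bochner_Integration.integral_cong refl)
         (simp add: left_diff_distrib sum_distrib_right mult.assoc cis_mult distrib_left distrib_right)
    also have "\<dots> = (\<integral>t. complex_of_real (h t) * cis (2 * pi * real_of_int n * t) \<partial>I01)
           - (\<Sum>m\<in>F. fourier_coeff h m * (\<integral>t. cis (2 * pi * real_of_int (m + n) * t) \<partial>I01))"
    proof -
      have "integrable I01 (\<lambda>t. complex_of_real (h t) * cis (2 * pi * real_of_int n * t))"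
        by (rule integrable_I01_bounded_mult[OF hc, where C = 1]) auto
      moreover have "has_bochner_integral I01
        (\<lambda>t. \<Sum>m\<in>F. fourier_coeff h m * cis (2 * pi * real_of_int (m + n) * t))
        (\<Sum>m\<in>F. fourier_coeff h m * (\<integral>t. cis (2 * pi * real_of_int (m + n) * t) \<partial>I01))"
        by (intro has_bochner_integral_sum has_bochner_integral_mult_right has_bochner_integral_integrable integrable_cis)
      ultimately show ?thesis by (simp only: has_bochner_integral_iff Bochner_Integration.integral_diff)
    qed
    \<comment> \<open>\<open>fourier_null\<close> tests with the sign opposite to
      \<open>fourier_coeff\<close>, hence the frequency \<open>- n\<close>.\<close>
    also have "(\<integral>t. complex_of_real (h t) * cis (2 * pi * real_of_int n * t) \<partial>I01) = fourier_coeff h (- n)"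
      by (simp add: fourier_coeff_def)
    also have "(\<Sum>m\<in>F. fourier_coeff h m * (\<integral>t. cis (2 * pi * real_of_int (m + n) * t) \<partial>I01))
       = (\<Sum>m\<in>F. if m = - n then fourier_coeff h (- n) else 0)"
      unfolding integral_cis_int by (intro sum.cong) (auto simp: eq_neg_iff_add_eq_0[symmetric])
    also have "\<dots> = fourier_coeff h (- n)" using F by simp
    finally show "(\<integral>t. (complex_of_real (h t) - ?T t) * cis (2 * pi * real_of_int n * t) \<partial>I01) = 0" by simp
  qed
  from fourier_null_AE[OF this] show ?thesis by simp
qed

text \<open>The Bochner integral of a non-integrable function is 0 by convention, so a nonzero
  coefficient certifies integrability. The lower bound on the coefficients of \<open>g u\<close> is
  exploited in this way.\<close>

lemma integrable_fourier_coeff: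
  assumes "fourier_coeff G m \<noteq> 0"
  shows "integrable I01 G"
proof -
  have "integrable I01 (\<lambda>t. complex_of_real (G t) * cis (- 2 * pi * real_of_int m * t))"
    using assms not_integrable_integral_eq unfolding fourier_coeff_def by blast
  then have "integrable I01 (\<lambda>t. complex_of_real (G t) * cis (- 2 * pi * real_of_int m * t) * cis (2 * pi * real_of_int m * t))"
    by (rule integrable_I01_bounded_mult[where C = 1]) auto
  then have "integrable I01 (\<lambda>t. complex_of_real (G t))" by (simp add: mult.assoc cis_mult)
  from integrable_Re[OF this] show ?thesis by simp
qed

lemma L2_I01_integrable: "h \<in> L2 I01 \<Longrightarrow> integrable I01 h"
proof -
  assume "h \<in> L2 I01"
  moreover have "(\<lambda>_. 1) \<in> L2 I01"
    using I01.emeasure_finite[of "{0..1}"] by (simp add: L2_def top.not_eq_extremum[symmetric])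
  ultimately show ?thesis using L2_integrable_mult[of h I01 "\<lambda>_. 1"] by simp
qed

text \<open>\<open>G\<close> is merely integrable, so Parseval is not applied to it. Instead
  \<open>h\<close> is a.e. a finite sum of exponentials; changing it on a null set is invisible to
  the integral, so the convolution equals, at every \<open>t\<close>, a trigonometric polynomial
  with coefficients multiplied by those of \<open>G\<close>. Parseval for finite sums before and
  after gives the factor \<open>B\<close>.\<close>

lemma convolution_band_limited:
  assumes per: "\<And>x. G (x + 1) = G x" and [measurable]: "G \<in> borel_measurable borel" and G: "integrable I01 G"
    and h: "h \<in> L2 I01" and F: "finite F" "\<And>m. m \<notin> F \<Longrightarrow> fourier_coeff h m = 0"
    and B: "\<And>m. m \<in> F \<Longrightarrow> (cmod (fourier_coeff G m))\<^sup>2 \<le> B"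
  shows "integrable I01 (\<lambda>x. G (t - x) * h x)"
    and "(\<integral>\<^sup>+t. ennreal ((\<integral>x. G (t - x) * h x \<partial>I01)\<^sup>2) \<partial>I01) \<le> ennreal (B * ip I01 h h)"
proof -
  define c where "c m = fourier_coeff h m" for m
  have hi: "integrable I01 h" using h by (rule L2_I01_integrable)
  have hm [measurable]: "h \<in> borel_measurable I01" using hi by simp
  have rep: "AE t in I01. complex_of_real (h t) = (\<Sum>m\<in>F. c m * cis (2 * pi * real_of_int m * t))"
    unfolding c_def by (rule trig_representation[OF hi F])
  \<comment> \<open>Exponentials are eigenfunctions of convolution with \<open>G\<close>: substitute
    \<open>y = t - x\<close> over a full period.\<close>
  have tm: "has_bochner_integral I01 (\<lambda>x. complex_of_real (G (t - x)) * cis (2 * pi * real_of_int m * x))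
      (cis (2 * pi * real_of_int m * t) * fourier_coeff G m)" for m t
  proof -
    let ?k = "\<lambda>y. complex_of_real (G y) * cis (- 2 * pi * real_of_int m * y)"
    have p1: "cis (- 2 * pi * real_of_int m * (x + 1)) = cis (- 2 * pi * real_of_int m * x)" for x
    proof -
      have "cis (2 * pi * real_of_int (- m)) = 1" by (rule cis_multiple_2pi) simp
      then have "cis (- 2 * pi * real_of_int m * x) = cis (- 2 * pi * real_of_int m * x) * cis (2 * pi * real_of_int (- m))"
        by (simp only: mult_1_right)
      then show ?thesis unfolding cis_mult by (simp add: algebra_simps)
    qed
    have 1: "integrable I01 ?k"
    proof (rule integrable_I01_bounded_mult[where C = 1])
      show "(\<lambda>y. cis (- 2 * pi * real_of_int m * y)) \<in> borel_measurable I01"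
        by (rule measurable_cis_mult)
    qed (use G in auto)
    have 2: "?k \<in> borel_measurable borel"
    proof -
      have "(\<lambda>y. cis (- 2 * pi * real_of_int m * y)) \<in> borel_measurable borel"
        by (intro borel_measurable_continuous_onI continuous_intros)
      then show ?thesis by (intro borel_measurable_times) auto
    qed
    have "?k (x + 1) = ?k x" for x unfolding p1 per ..
    from has_bochner_integral_periodic[OF this 1 2, of t]
    have "has_bochner_integral I01 (\<lambda>x. ?k (t - x)) (fourier_coeff G m)"
      by (simp add: fourier_coeff_def)
    from has_bochner_integral_mult_right[OF this, of "cis (2 * pi * real_of_int m * t)"]
    have "has_bochner_integral I01 (\<lambda>x. cis (2 * pi * real_of_int m * t) * ?k (t - x))
      (cis (2 * pi * real_of_int m * t) * fourier_coeff G m)" by simp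
    moreover have "cis (2 * pi * real_of_int m * t) * ?k (t - x)
       = complex_of_real (G (t - x)) * cis (2 * pi * real_of_int m * x)" for x
    proof -
      have "cis (2 * pi * real_of_int m * t) * cis (- 2 * pi * real_of_int m * (t - x)) = cis (2 * pi * real_of_int m * x)"
        unfolding cis_mult by (simp add: algebra_simps)
      then show ?thesis by (metis mult.left_commute)
    qed
    ultimately show ?thesis by (simp only:)
  qed
  have Gm: "(\<lambda>x. G (t - x)) \<in> borel_measurable I01" for t
    by (intro measurable_I01) measurable
  have conv: "has_bochner_integral I01 (\<lambda>x. complex_of_real (G (t - x) * h x))
     (\<Sum>m\<in>F. (fourier_coeff G m * c m) * cis (2 * pi * real_of_int m * t))" for t
  proof -
    have s: "has_bochner_integral I01 (\<lambda>x. \<Sum>m\<in>F. c m * (complex_of_real (G (t - x)) * cis (2 * pi * real_of_int m * x)))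
     (\<Sum>m\<in>F. c m * (cis (2 * pi * real_of_int m * t) * fourier_coeff G m))"
      by (intro has_bochner_integral_sum has_bochner_integral_mult_right tm)
    have "AE x in I01. (\<Sum>m\<in>F. c m * (complex_of_real (G (t - x)) * cis (2 * pi * real_of_int m * x)))
       = complex_of_real (G (t - x) * h x)"
      using rep by eventually_elim (simp add: sum_distrib_left mult_ac)
    from has_bochner_integral_cong_AE[THEN iffD1, OF _ _ this s] s Gm[of t]
    have "has_bochner_integral I01 (\<lambda>x. complex_of_real (G (t - x) * h x))
     (\<Sum>m\<in>F. c m * (cis (2 * pi * real_of_int m * t) * fourier_coeff G m))"
      by (simp add: has_bochner_integral_iff)
    then show ?thesis by (simp add: mult_ac)
  qed
  show "integrable I01 (\<lambda>x. G (t - x) * h x)"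
    using has_bochner_integral_Re[OF conv] by (simp add: has_bochner_integral_iff)
  have val: "(\<integral>x. G (t - x) * h x \<partial>I01)\<^sup>2
     = (cmod (\<Sum>m\<in>F. (fourier_coeff G m * c m) * cis (2 * pi * real_of_int m * t)))\<^sup>2" for t
  proof -
    have "complex_of_real (\<integral>x. G (t - x) * h x \<partial>I01)
      = (\<Sum>m\<in>F. (fourier_coeff G m * c m) * cis (2 * pi * real_of_int m * t))"
      using has_bochner_integral_integral_eq[OF conv[of t]] by (simp only: integral_complex_of_real)
    from arg_cong[OF this, of "\<lambda>z. (cmod z)\<^sup>2"] show ?thesis by simp
  qed
  have "(\<Sum>m\<in>F. (cmod (c m))\<^sup>2) = (\<integral>t. h t * h t \<partial>I01)"
  proof -
    have "(\<integral>t. h t * h t \<partial>I01) = (\<integral>t. (cmod (\<Sum>m\<in>F. c m * cis (2 * pi * real_of_int m * t)))\<^sup>2 \<partial>I01)"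
    proof (rule integral_cong_AE)
      show "AE t in I01. h t * h t = (cmod (\<Sum>m\<in>F. c m * cis (2 * pi * real_of_int m * t)))\<^sup>2"
        using rep by eventually_elim (simp flip: power2_eq_square, metis norm_of_real power2_abs)
    qed measurable
    then show ?thesis using trig_parseval[OF F(1), of c] by (simp add: has_bochner_integral_iff)
  qed
  then have hh: "(\<Sum>m\<in>F. (cmod (c m))\<^sup>2) = ip I01 h h" by (simp add: ip_def)
  have "(\<integral>\<^sup>+t. ennreal ((\<integral>x. G (t - x) * h x \<partial>I01)\<^sup>2) \<partial>I01)
     = ennreal (\<Sum>m\<in>F. (cmod (fourier_coeff G m * c m))\<^sup>2)"
    unfolding val using trig_parseval[OF F(1), of "\<lambda>m. fourier_coeff G m * c m"]
    by (subst nn_integral_eq_integral) (auto simp: has_bochner_integral_iff)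
  also have "\<dots> \<le> ennreal (\<Sum>m\<in>F. B * (cmod (c m))\<^sup>2)"
    by (intro ennreal_leI sum_mono) (auto simp: norm_mult power_mult_distrib intro!: mult_right_mono B)
  also have "\<dots> = ennreal (B * ip I01 h h)" by (simp add: sum_distrib_left[symmetric] hh)
  finally show "(\<integral>\<^sup>+t. ennreal ((\<integral>x. G (t - x) * h x \<partial>I01)\<^sup>2) \<partial>I01) \<le> ennreal (B * ip I01 h h)" .
qed

section \<open>Integration over the cube and tensor wavelets\<close>

lemma unit_cube_eq_cbox: "unit_cube = cbox (0::real^'r) 1"
  by (auto simp: unit_cube_def mem_box_cart)

lemma unit_cube_borel [measurable, simp]: "(unit_cube :: (real^'r) set) \<in> sets borel"
  unfolding unit_cube_eq_cbox by simp

definition Cube :: "(real^'r) measure" where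
  "Cube = restrict_space lborel unit_cube"

lemma space_Cube [simp]: "space Cube = unit_cube"
  by (simp add: Cube_def space_restrict_space)

lemma finite_measure_Cube: "finite_measure Cube"
proof
  have "emeasure lborel (unit_cube :: (real^'r) set) \<noteq> \<infinity>"
    unfolding unit_cube_eq_cbox using emeasure_lborel_cbox_finite by (simp add: top.not_eq_extremum)
  then show "emeasure Cube (space (Cube :: (real^'r) measure)) \<noteq> \<infinity>"
    by (simp add: Cube_def emeasure_restrict_space space_restrict_space)
qed

interpretation Cube: finite_measure Cube by (rule finite_measure_Cube)

interpretation CubeI: pair_sigma_finite Cube I01 ..

text \<open>Opens the way to Fubini between the spatial variable and \<open>t\<close>.\<close>

lemma Dom_eq_pair: "(Dom :: ((real^'r) \<times> real) measure) = Cube \<Otimes>\<^sub>M I01"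
proof (rule pair_measure_eqI[symmetric])
  have b: "sets (borel :: ((real^'r) \<times> real) measure) = sets (borel \<Otimes>\<^sub>M borel)" by (simp add: borel_prod[symmetric])
  have U [measurable]: "(unit_cube :: (real^'r) set) \<times> {0..1::real} \<in> sets borel"
    unfolding b by (intro pair_measureI) auto
  show sets: "sets (Cube \<Otimes>\<^sub>M I01) = sets (Dom :: ((real^'r) \<times> real) measure)"
  proof
    show "sets (Cube \<Otimes>\<^sub>M I01) \<subseteq> sets (Dom :: ((real^'r) \<times> real) measure)"
      unfolding sets_pair_measure
    proof (intro sets.sigma_sets_subset', safe)
      fix A B assume "A \<in> sets (Cube :: (real^'r) measure)" "B \<in> sets I01"
      then obtain A' B' where AB: "A' \<in> sets borel" "B' \<in> sets borel" "A = unit_cube \<inter> A'" "B = {0..1} \<inter> B'"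
        by (auto simp: Cube_def I01_def sets_restrict_space)
      have "A' \<times> B' \<in> sets (borel :: ((real^'r) \<times> real) measure)" unfolding b using AB by (intro pair_measureI)
      moreover have "A \<times> B = (unit_cube \<times> {0..1}) \<inter> (A' \<times> B')" using AB by auto
      ultimately show "A \<times> B \<in> sets Dom" by (auto simp: Dom_def sets_restrict_space)
    next
      show "space Cube \<times> space I01 \<in> sets (Dom :: ((real^'r) \<times> real) measure)"
        using sets.top[of "Dom :: ((real^'r) \<times> real) measure"] by (simp add: Dom_def space_restrict_space)
    qed
    show "sets (Dom :: ((real^'r) \<times> real) measure) \<subseteq> sets (Cube \<Otimes>\<^sub>M I01)"
    proof
      fix X :: "((real^'r) \<times> real) set" assume "X \<in> sets Dom"
      then obtain Y where Y: "Y \<in> sets (borel \<Otimes>\<^sub>M borel)" "X = (unit_cube \<times> {0..1}) \<inter> Y"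
        by (auto simp: Dom_def sets_restrict_space b)
      have "(\<lambda>x. x) \<in> measurable Cube borel" "(\<lambda>x. x) \<in> measurable I01 borel"
        unfolding Cube_def I01_def by (auto intro: measurable_restrict_space1)
      then have "(\<lambda>x. (fst x, snd x)) \<in> measurable (Cube \<Otimes>\<^sub>M I01) (borel \<Otimes>\<^sub>M borel)"
        by (intro measurable_Pair) (auto intro: measurable_compose[OF measurable_fst] measurable_compose[OF measurable_snd])
      from measurable_sets[OF this Y(1)] show "X \<in> sets (Cube \<Otimes>\<^sub>M I01)"
        using Y(2) by (simp add: space_pair_measure vimage_def Int_def conj_commute)
    qed
  qed
  fix A B assume A: "A \<in> sets (Cube :: (real^'r) measure)" and B: "B \<in> sets I01"
  then have AB: "A \<in> sets borel" "B \<in> sets borel" "A \<subseteq> unit_cube" "B \<subseteq> {0..1}"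
    by (auto simp: Cube_def I01_def sets_restrict_space)
  have "emeasure (lborel \<Otimes>\<^sub>M lborel) (A \<times> B) = emeasure lborel A * emeasure lborel B"
    using AB by (intro lborel.emeasure_pair_measure_Times) auto
  moreover have "A \<times> B \<subseteq> unit_cube \<times> {0..1}" using AB by auto
  ultimately show "emeasure Cube A * emeasure I01 B = emeasure (Dom :: ((real^'r) \<times> real) measure) (A \<times> B)"
    using AB U by (simp add: Cube_def I01_def Dom_def emeasure_restrict_space lborel_prod)
qed (rule Cube.sigma_finite_measure_axioms I01.sigma_finite_measure_axioms)+

lemma measurable_vec_lambda [measurable]:
  "(\<lambda>f. (\<chi> l. f l) :: real^'r) \<in> measurable (\<Pi>\<^sub>M l\<in>UNIV. lborel) borel"
proof (rule borel_measurable_euclidean_space[THEN iffD2, rule_format])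
  fix i :: "real^'r" assume "i \<in> Basis"
  then obtain l where i: "i = axis l 1" by (auto simp: Basis_vec_def)
  show "(\<lambda>f. (\<chi> l. f l) \<bullet> i) \<in> borel_measurable (\<Pi>\<^sub>M l\<in>(UNIV::'r set). lborel)"
    unfolding i by (simp add: inner_axis)
qed

text \<open>Indexes the product by the coordinate type instead of by basis vectors, so that
  integrals of products of one-coordinate functions factorise. Agreement on boxes suffices.\<close>

lemma lborel_eq_distr_PiM:
  "(lborel :: (real^'r) measure) = distr (\<Pi>\<^sub>M l\<in>UNIV. lborel) borel (\<lambda>f. \<chi> l. f l)"
proof (rule lborel_eqI)
  interpret product_sigma_finite "\<lambda>_::'r. lborel :: real measure" ..
  fix a b :: "real^'r" assume "\<And>i. i \<in> Basis \<Longrightarrow> a \<bullet> i \<le> b \<bullet> i"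
  then have "a \<bullet> axis l 1 \<le> b \<bullet> axis l 1" for l by (auto simp: Basis_vec_def)
  then have le: "a $ l \<le> b $ l" for l by (simp add: inner_axis)
  have "(\<lambda>f. \<chi> l. f l) -` box a b \<inter> space (\<Pi>\<^sub>M l\<in>(UNIV::'r set). lborel) = Pi\<^sub>E UNIV (\<lambda>l. {a $ l <..< b $ l})"
    by (auto simp: mem_box_cart space_PiM PiE_iff)
  then have "emeasure (distr (\<Pi>\<^sub>M l\<in>(UNIV::'r set). lborel) borel (\<lambda>f. \<chi> l. f l)) (box a b)
     = emeasure (\<Pi>\<^sub>M l\<in>(UNIV::'r set). lborel) (Pi\<^sub>E UNIV (\<lambda>l. {a $ l <..< b $ l}))"
    by (simp add: emeasure_distr)
  also have "\<dots> = (\<Prod>l\<in>UNIV. ennreal (b $ l - a $ l))"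
    using le by (subst emeasure_PiM) auto
  also have "\<dots> = ennreal (\<Prod>i\<in>Basis. (b - a) \<bullet> i)"
  proof -
    have "(\<Prod>i\<in>Basis. (b - a) \<bullet> i) = (\<Prod>l\<in>UNIV. (b - a) \<bullet> axis l 1)"
      by (rule prod.reindex_cong[of "\<lambda>l. axis l 1"]) (auto simp: inj_on_def axis_eq_axis Basis_vec_def)
    also have "\<dots> = (\<Prod>l\<in>UNIV. b $ l - a $ l)" by (simp add: inner_axis)
    finally show ?thesis using le by (simp add: prod_ennreal)
  qed
  finally show "emeasure (distr (\<Pi>\<^sub>M l\<in>(UNIV::'r set). lborel) borel (\<lambda>f. \<chi> l. f l)) (box a b) = (\<Prod>i\<in>Basis. (b - a) \<bullet> i)" .
qed simp

lemma has_bochner_integral_Cube_prod: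
  fixes a :: "'r::finite \<Rightarrow> real \<Rightarrow> real"
  assumes a: "\<And>l. integrable I01 (a l)"
  shows "has_bochner_integral Cube (\<lambda>u. \<Prod>l\<in>UNIV. a l (u $ l)) (\<Prod>l\<in>UNIV. \<integral>x. a l x \<partial>I01)"
proof -
  interpret product_sigma_finite "\<lambda>_::'r. lborel :: real measure" ..
  define h where "h l x = indicator {0..1} x * a l x" for l x
  have hi: "integrable lborel (h l)" for l
    using a[of l] unfolding h_def I01_def by (subst (asm) integrable_restrict_space) auto
  have hI: "(\<integral>x. h l x \<partial>lborel) = (\<integral>x. a l x \<partial>I01)" for l
    unfolding h_def I01_def by (subst integral_restrict_space) auto
  have [measurable]: "h l \<in> borel_measurable borel" for l using hi[of l] by auto
  have hm: "(\<lambda>u::real^'r. \<Prod>l\<in>UNIV. h l (u $ l)) \<in> borel_measurable borel"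
    by measurable
  have "has_bochner_integral (\<Pi>\<^sub>M l\<in>UNIV. lborel) (\<lambda>f. \<Prod>l\<in>UNIV. h l (f l)) (\<Prod>l\<in>UNIV. \<integral>x. a l x \<partial>I01)"
    using product_integrable_prod[OF _ hi, of UNIV] product_integral_prod[OF _ hi, of UNIV]
    by (simp add: has_bochner_integral_iff hI)
  then have "has_bochner_integral lborel (\<lambda>u::real^'r. \<Prod>l\<in>UNIV. h l (u $ l)) (\<Prod>l\<in>UNIV. \<integral>x. a l x \<partial>I01)"
    unfolding lborel_eq_distr_PiM using hm
    by (subst has_bochner_integral_distr) auto
  moreover have "(\<Prod>l\<in>UNIV. h l (u $ l)) = indicator unit_cube u *\<^sub>R (\<Prod>l\<in>UNIV. a l (u $ l))" for u :: "real^'r"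
  proof (cases "u \<in> unit_cube")
    case True
    then show ?thesis by (auto simp: h_def unit_cube_def intro!: prod.cong)
  next
    case False
    then obtain l where "u $ l \<notin> {0..1}" by (auto simp: unit_cube_def)
    then have "h l (u $ l) = 0" by (simp add: h_def)
    then have "(\<Prod>l\<in>UNIV. h l (u $ l)) = 0" by (intro prod_zero) auto
    then show ?thesis using False by simp
  qed
  ultimately show ?thesis unfolding Cube_def
    by (subst has_bochner_integral_restrict_space) auto
qed

lemma has_bochner_integral_Dom_prod:
  fixes a :: "'r::finite \<Rightarrow> real \<Rightarrow> real"
  assumes b: "integrable I01 b" and a: "\<And>l. integrable I01 (a l)"
  shows "has_bochner_integral Dom (\<lambda>x. b (snd x) * (\<Prod>l\<in>UNIV. a l (fst x $ l)))
     ((\<integral>t. b t \<partial>I01) * (\<Prod>l\<in>UNIV. \<integral>x. a l x \<partial>I01))"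
proof -
  let ?H = "\<lambda>u::real^'r. \<Prod>l\<in>UNIV. a l (u $ l)"
  have H: "has_bochner_integral Cube ?H (\<Prod>l\<in>UNIV. \<integral>x. a l x \<partial>I01)"
    by (rule has_bochner_integral_Cube_prod[OF a])
  have Hi: "integrable Cube ?H" using H by (simp add: has_bochner_integral_iff)
  have i: "integrable (Cube \<Otimes>\<^sub>M I01) (\<lambda>x. b (snd x) * ?H (fst x))"
  proof (rule CubeI.Fubini_integrable)
    have [measurable]: "?H \<in> borel_measurable Cube" "b \<in> borel_measurable I01" using Hi b by simp_all
    show "(\<lambda>x. b (snd x) * ?H (fst x)) \<in> borel_measurable (Cube \<Otimes>\<^sub>M I01)" by measurable
    show "integrable Cube (\<lambda>u. \<integral>t. norm (b (snd (u, t)) * ?H (fst (u, t))) \<partial>I01)"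
      using Hi by (simp add: abs_mult)
    show "AE u in Cube. integrable I01 (\<lambda>t. b (snd (u, t)) * ?H (fst (u, t)))" using b by simp
  qed
  have "(\<integral>x. b (snd x) * ?H (fst x) \<partial>(Cube \<Otimes>\<^sub>M I01)) = (\<integral>u. \<integral>t. b t * ?H u \<partial>I01 \<partial>Cube)"
    using CubeI.integral_fst'[OF i] by simp
  then show ?thesis
    using i H unfolding Dom_eq_pair by (simp add: has_bochner_integral_iff)
qed

lemma finite_measure_Dom: "finite_measure (Dom :: ((real^'r) \<times> real) measure)"
  unfolding Dom_eq_pair by (rule finite_measure_pair_measure) unfold_locales

interpretation Dom: finite_measure Dom by (rule finite_measure_Dom)

lemma space_Dom [simp]: "space Dom = unit_cube \<times> {0..1}"
  by (simp add: Dom_def space_restrict_space space_pair_measure)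

section \<open>Assouad's bound in the white-noise model\<close>

lemma ip_cong: "(\<And>x. x \<in> space M \<Longrightarrow> f x = f' x) \<Longrightarrow> ip M f h = ip M f' h"
  unfolding ip_def by (intro Bochner_Integration.integral_cong) auto

text \<open>The coefficients \<open>ip Dom (fe \<omega>) (b i)\<close> of the estimator are the
  statistics fed to \<open>assouad\<close>. Inserting one index moves the mean sequence by
  \<open>\<gamma> * ip Dom (conv g (b i)) (\<phi> n)\<close>, whose squared length is at most
  \<open>\<epsilon>\<^sup>2\<close> by Bessel and \<open>cB\<close>. Linearity is a hypothesis
  because \<open>conv\<close> is a Bochner integral and additive only where the summands are
  integrable; for tensor wavelets the band limit supplies this.\<close>

lemma minimax_risk_ge_hypercube:
  fixes b :: "'i \<Rightarrow> (real^'r) \<times> real \<Rightarrow> real"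
  assumes \<phi>: "orthonormal_basis Dom UNIV \<phi>" and \<epsilon>: "\<epsilon> > 0" and \<gamma>: "\<gamma> \<ge> 0" and K: "finite K"
    and b: "\<And>i. i \<in> K \<Longrightarrow> b i \<in> L2 Dom"
    and on: "\<And>i j. i \<in> K \<Longrightarrow> j \<in> K \<Longrightarrow> ip Dom (b i) (b j) = (if i = j then 1 else 0)"
    and V: "\<And>T. T \<subseteq> K \<Longrightarrow> (\<lambda>x. \<Sum>i\<in>T. \<gamma> * b i x) \<in> V"
    and lin: "\<And>T x. T \<subseteq> K \<Longrightarrow> x \<in> space Dom \<Longrightarrow>
        conv g (\<lambda>x. \<Sum>i\<in>T. \<gamma> * b i x) x = (\<Sum>i\<in>T. \<gamma> * conv g (b i) x)"
    and cL: "\<And>i. i \<in> K \<Longrightarrow> conv g (b i) \<in> L2 Dom"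
    and cB: "\<And>i. i \<in> K \<Longrightarrow> \<gamma>\<^sup>2 * ip Dom (conv g (b i)) (conv g (b i)) \<le> \<epsilon>\<^sup>2"
  shows "ennreal (\<gamma>\<^sup>2 * card K / 128) \<le> minimax_risk g \<phi> \<epsilon> V"
  unfolding minimax_risk_def
proof (rule INF_greatest)
  fix fe :: "(nat \<Rightarrow> real) \<Rightarrow> (real^'r) \<times> real \<Rightarrow> real" assume "fe \<in> estimators"
  then have fe: "(\<lambda>(\<omega>,x). fe \<omega> x) \<in> borel_measurable ((\<Pi>\<^sub>M n\<in>UNIV. borel) \<Otimes>\<^sub>M Dom)"
    by (simp add: estimators_def)
  let ?W = "\<Pi>\<^sub>M n\<in>(UNIV::nat set). (borel :: real measure)"
  define f where "f T x = (\<Sum>i\<in>T. \<gamma> * b i x)" for T x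
  have fL: "f T \<in> L2 Dom" if "T \<subseteq> K" for T
    unfolding f_def using that K b by (intro L2_sum L2_scale) (auto intro: finite_subset)
  have fb: "ip Dom (f T) (b i) = (if i \<in> T then \<gamma> else 0)" if T: "T \<subseteq> K" and i: "i \<in> K" for T i
  proof -
    have fT: "finite T" using T K finite_subset by blast
    have "ip Dom (f T) (b i) = (\<Sum>j\<in>T. \<gamma> * ip Dom (b j) (b i))"
      unfolding f_def using T b i by (subst ip_sum_left[OF fT]) (auto intro: L2_scale simp: ip_scale_left)
    also have "\<dots> = (\<Sum>j\<in>T. if j = i then \<gamma> else 0)"
      using T i by (intro sum.cong) (auto simp: on)
    finally show ?thesis using fT by simp
  qed
  define mean where "mean T n = ip Dom (conv g (f T)) (\<phi> n)" for T n
  have \<phi>L: "\<phi> n \<in> L2 Dom" and \<phi>on: "ip Dom (\<phi> n) (\<phi> n') = (if n = n' then 1 else 0)" for n n'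
    using \<phi> by (auto simp: orthonormal_basis_def)
  have mean: "mean T n = (\<Sum>i\<in>T. \<gamma> * ip Dom (conv g (b i)) (\<phi> n))" if T: "T \<subseteq> K" for T n
  proof -
    have fT: "finite T" using T K finite_subset by blast
    have "mean T n = ip Dom (\<lambda>x. \<Sum>i\<in>T. \<gamma> * conv g (b i) x) (\<phi> n)"
      unfolding mean_def f_def by (rule ip_cong) (rule lin[OF T])
    then show ?thesis
      using T cL \<phi>L by (subst (asm) ip_sum_left[OF fT]) (auto intro: L2_scale simp: ip_scale_left)
  qed
  let ?R = "SUP f\<in>V. \<integral>\<^sup>+ \<omega>. (\<integral>\<^sup>+ x. ennreal ((fe \<omega> x - f x)\<^sup>2) \<partial>Dom) \<partial>obs_law g \<phi> \<epsilon> f"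
  have obs: "obs_law g \<phi> \<epsilon> (f T) = (\<Pi>\<^sub>M n\<in>UNIV. density lborel (normal_density (mean T n) \<epsilon>))" for T
    by (simp add: obs_law_def mean_def)
  have obs_sets: "sets (obs_law g \<phi> \<epsilon> (f T)) = sets ?W" for T
    unfolding obs by (intro sets_PiM_cong) auto
  have "ennreal (1/16 * \<gamma>\<^sup>2 * card K / 8) \<le> ?R"
  proof (rule assouad[where P = "\<lambda>T. obs_law g \<phi> \<epsilon> (f T)" and W = ?W and a = "\<lambda>i \<omega>. ip Dom (fe \<omega>) (b i)", OF K obs_sets])
    fix i assume i: "i \<in> K"
    have [measurable]: "b i \<in> borel_measurable Dom" using b[OF i] by (simp add: L2_def)
    have "(\<lambda>(\<omega>,x). fe \<omega> x * b i x) \<in> borel_measurable (?W \<Otimes>\<^sub>M Dom)"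
      using fe unfolding case_prod_beta by measurable
    then show "(\<lambda>\<omega>. ip Dom (fe \<omega>) (b i)) \<in> borel_measurable ?W"
      unfolding ip_def by (intro Dom.borel_measurable_lebesgue_integral)
  next
    fix T i B assume T: "T \<subseteq> K" and i: "i \<in> K" "i \<notin> T" and B: "B \<in> sets ?W"
    have "(\<Sum>n\<in>J. (mean (insert i T) n - mean T n)\<^sup>2) \<le> \<epsilon>\<^sup>2" if J: "finite J" for J
    proof -
      have fT: "finite T" using T K finite_subset by blast
      have "mean (insert i T) n - mean T n = \<gamma> * ip Dom (conv g (b i)) (\<phi> n)" for n
        using T i fT by (subst (1 2) mean) auto
      then have "(\<Sum>n\<in>J. (mean (insert i T) n - mean T n)\<^sup>2) = \<gamma>\<^sup>2 * (\<Sum>n\<in>J. (ip Dom (conv g (b i)) (\<phi> n))\<^sup>2)"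
        by (simp add: power_mult_distrib sum_distrib_left)
      also have "\<dots> \<le> \<gamma>\<^sup>2 * ip Dom (conv g (b i)) (conv g (b i))"
        by (intro mult_left_mono bessel J \<phi>L \<phi>on cL i) auto
      also have "\<dots> \<le> \<epsilon>\<^sup>2" by (rule cB[OF i(1)])
      finally show ?thesis .
    qed
    from gaussian_test_error[OF \<epsilon> this B]
    show "ennreal (1/16) \<le> emeasure (obs_law g \<phi> \<epsilon> (f T)) B + emeasure (obs_law g \<phi> \<epsilon> (f (insert i T))) (space ?W - B)"
      unfolding obs by (simp add: space_PiM Compl_eq_Diff_UNIV)
  next
    fix T assume T: "T \<subseteq> K"
    have sp: "space (obs_law g \<phi> \<epsilon> (f T)) = UNIV"
      unfolding obs by (simp add: space_PiM)
    have fem: "fe \<omega> \<in> borel_measurable Dom" for \<omega>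
      using measurable_compose[OF measurable_Pair1' fe, of \<omega>] by (simp add: space_PiM)
    have "(\<integral>\<^sup>+\<omega>. (\<Sum>i\<in>K. ennreal ((ip Dom (fe \<omega>) (b i) - (if i \<in> T then \<gamma> else 0))\<^sup>2)) \<partial>obs_law g \<phi> \<epsilon> (f T))
       \<le> (\<integral>\<^sup>+ \<omega>. (\<integral>\<^sup>+ x. ennreal ((fe \<omega> x - f T x)\<^sup>2) \<partial>Dom) \<partial>obs_law g \<phi> \<epsilon> (f T))"
    proof (rule nn_integral_mono)
      fix \<omega>
      have "(\<Sum>i\<in>K. ennreal ((ip Dom (fe \<omega>) (b i) - (if i \<in> T then \<gamma> else 0))\<^sup>2))
         = (\<Sum>i\<in>K. ennreal ((ip Dom (fe \<omega>) (b i) - ip Dom (f T) (b i))\<^sup>2))"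
        using fb[OF T] by (intro sum.cong) auto
      also have "\<dots> \<le> (\<integral>\<^sup>+ x. ennreal ((fe \<omega> x - f T x)\<^sup>2) \<partial>Dom)"
        by (intro loss_ge_coefficients K b on fem fL T)
      finally show "(\<Sum>i\<in>K. ennreal ((ip Dom (fe \<omega>) (b i) - (if i \<in> T then \<gamma> else 0))\<^sup>2))
         \<le> (\<integral>\<^sup>+ x. ennreal ((fe \<omega> x - f T x)\<^sup>2) \<partial>Dom)" .
    qed
    also have "\<dots> \<le> ?R" using V[OF T] unfolding f_def by (rule SUP_upper)
    finally show "(\<integral>\<^sup>+\<omega>. (\<Sum>i\<in>K. ennreal ((ip Dom (fe \<omega>) (b i) - (if i \<in> T then \<gamma> else 0))\<^sup>2)) \<partial>obs_law g \<phi> \<epsilon> (f T)) \<le> ?R" .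
  qed (use \<gamma> in auto)
  then show "ennreal (\<gamma>\<^sup>2 * card K / 128) \<le> ?R" by simp
qed

section \<open>Tensor wavelets and their images under convolution\<close>

definition tens :: "(int \<Rightarrow> nat \<Rightarrow> real \<Rightarrow> real) \<Rightarrow> (int \<Rightarrow> nat \<Rightarrow> real \<Rightarrow> real) \<Rightarrow> int \<Rightarrow> ('r::finite \<Rightarrow> int) \<Rightarrow>
    nat \<times> ('r \<Rightarrow> nat) \<Rightarrow> (real^'r) \<times> real \<Rightarrow> real" where
  "tens \<psi> \<eta> j j' \<kappa> x = \<psi> j (fst \<kappa>) (snd x) * (\<Prod>l\<in>UNIV. \<eta> (j' l) (snd \<kappa> l) (fst x $ l))"

lemma beta_eq_ip: "beta \<psi> \<eta> f j k j' k' = ip Dom f (tens \<psi> \<eta> j j' (k, k'))"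
  by (simp add: beta_def ip_def tens_def mult.assoc)

lemma wav_index_level:
  assumes "(j, j') \<in> level_set m0 m0'" "\<kappa> \<in> shift_set m0 m0' j j'"
  shows "(j, fst \<kappa>) \<in> wav_index m0" "(j' l, snd \<kappa> l) \<in> wav_index m0'"
  using assms by (auto simp: level_set_def shift_set_def wav_index_def)

lemma tens_L2_ip:
  assumes \<psi>: "orthonormal_basis I01 (wav_index m0) (\<lambda>(j,k). \<psi> j k)"
    and \<eta>: "orthonormal_basis I01 (wav_index m0') (\<lambda>(j,k). \<eta> j k)"
    and jk: "(j, j') \<in> level_set m0 m0'" "\<kappa> \<in> shift_set m0 m0' j j'"
    and il: "(i, i') \<in> level_set m0 m0'" "\<mu> \<in> shift_set m0 m0' i i'"
  shows "tens \<psi> \<eta> j j' \<kappa> \<in> L2 Dom"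
    and "ip Dom (tens \<psi> \<eta> j j' \<kappa>) (tens \<psi> \<eta> i i' \<mu>) = (if j = i \<and> j' = i' \<and> \<kappa> = \<mu> then 1 else 0)"
proof -
  have \<psi>L: "\<psi> a b \<in> L2 I01" if "(a, b) \<in> wav_index m0" for a b
    using \<psi> that by (auto simp: orthonormal_basis_def)
  have \<psi>o: "(\<integral>x. \<psi> a b x * \<psi> c d x \<partial>I01) = (if (a, b) = (c, d) then 1 else 0)"
    if "(a, b) \<in> wav_index m0" "(c, d) \<in> wav_index m0" for a b c d
    using \<psi> that by (fastforce simp: orthonormal_basis_def ip_def)
  have \<eta>L: "\<eta> a b \<in> L2 I01" if "(a, b) \<in> wav_index m0'" for a b
    using \<eta> that by (auto simp: orthonormal_basis_def)
  have \<eta>o: "(\<integral>x. \<eta> a b x * \<eta> c d x \<partial>I01) = (if (a, b) = (c, d) then 1 else 0)"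
    if "(a, b) \<in> wav_index m0'" "(c, d) \<in> wav_index m0'" for a b c d
    using \<eta> that by (fastforce simp: orthonormal_basis_def ip_def)
  note w1 = wav_index_level[OF jk] and w2 = wav_index_level[OF il]
  have prod: "has_bochner_integral Dom (\<lambda>x. tens \<psi> \<eta> a a' \<alpha> x * tens \<psi> \<eta> c c' \<beta> x)
     ((\<integral>x. \<psi> a (fst \<alpha>) x * \<psi> c (fst \<beta>) x \<partial>I01)
      * (\<Prod>l\<in>UNIV. \<integral>x. \<eta> (a' l) (snd \<alpha> l) x * \<eta> (c' l) (snd \<beta> l) x \<partial>I01))"
    if 1: "(a, fst \<alpha>) \<in> wav_index m0" "\<And>l. (a' l, snd \<alpha> l) \<in> wav_index m0'"
      and 2: "(c, fst \<beta>) \<in> wav_index m0" "\<And>l. (c' l, snd \<beta> l) \<in> wav_index m0'" for a a' \<alpha> c c' \<beta>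
  proof -
    have "has_bochner_integral Dom (\<lambda>x. (\<psi> a (fst \<alpha>) (snd x) * \<psi> c (fst \<beta>) (snd x))
        * (\<Prod>l\<in>UNIV. \<eta> (a' l) (snd \<alpha> l) (fst x $ l) * \<eta> (c' l) (snd \<beta> l) (fst x $ l)))
     ((\<integral>x. \<psi> a (fst \<alpha>) x * \<psi> c (fst \<beta>) x \<partial>I01)
      * (\<Prod>l\<in>UNIV. \<integral>x. \<eta> (a' l) (snd \<alpha> l) x * \<eta> (c' l) (snd \<beta> l) x \<partial>I01))"
      by (rule has_bochner_integral_Dom_prod) (intro L2_integrable_mult \<psi>L \<eta>L 1 2)+
    then show ?thesis by (simp add: tens_def prod.distrib mult_ac)
  qed
  show "tens \<psi> \<eta> j j' \<kappa> \<in> L2 Dom"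
  proof -
    have "has_bochner_integral Dom (tens \<psi> \<eta> j j' \<kappa>) ((\<integral>x. \<psi> j (fst \<kappa>) x \<partial>I01)
      * (\<Prod>l\<in>UNIV. \<integral>x. \<eta> (j' l) (snd \<kappa> l) x \<partial>I01))"
      unfolding tens_def
      by (rule has_bochner_integral_Dom_prod) (intro L2_I01_integrable \<psi>L \<eta>L w1)+
    then have "tens \<psi> \<eta> j j' \<kappa> \<in> borel_measurable Dom" by (auto simp: has_bochner_integral_iff)
    moreover have "integrable Dom (\<lambda>x. (tens \<psi> \<eta> j j' \<kappa> x)\<^sup>2)"
      using prod[OF w1 w1] by (simp add: has_bochner_integral_iff power2_eq_square)
    ultimately show ?thesis by (auto simp: L2_def real_integrable_def top.not_eq_extremum)
  qed
  show "ip Dom (tens \<psi> \<eta> j j' \<kappa>) (tens \<psi> \<eta> i i' \<mu>) = (if j = i \<and> j' = i' \<and> \<kappa> = \<mu> then 1 else 0)"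
  proof -
    have "ip Dom (tens \<psi> \<eta> j j' \<kappa>) (tens \<psi> \<eta> i i' \<mu>)
      = (if (j, fst \<kappa>) = (i, fst \<mu>) then 1 else 0) *
        (\<Prod>l\<in>UNIV. if (j' l, snd \<kappa> l) = (i' l, snd \<mu> l) then 1 else 0)"
      using prod[OF w1 w2] \<psi>o[OF w1(1) w2(1)] \<eta>o[OF w1(2) w2(2)]
      by (simp add: has_bochner_integral_iff ip_def)
    also have "\<dots> = (if j = i \<and> j' = i' \<and> \<kappa> = \<mu> then 1 else 0)"
    proof (cases "\<forall>l. (j' l, snd \<kappa> l) = (i' l, snd \<mu> l)")
      case True
      then show ?thesis by (auto simp: fun_eq_iff prod_eq_iff)
    next
      case False
      then obtain l where "(j' l, snd \<kappa> l) \<noteq> (i' l, snd \<mu> l)" by blast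
      then have "(\<Prod>l\<in>UNIV. if (j' l, snd \<kappa> l) = (i' l, snd \<mu> l) then 1 else 0 :: real) = 0"
        by (intro prod_zero) auto
      then show ?thesis using False by auto
    qed
    finally show ?thesis .
  qed
qed

text \<open>Convolution acts in \<open>t\<close> with \<open>u\<close> fixed, so the spatial factor
  \<open>H\<close> comes out and a one-dimensional convolution \<open>W\<close> remains. Its squared
  norm is at most \<open>B\<close> uniformly in \<open>u\<close>, and \<open>H\<close> has norm 1 on
  the cube. The integrability claim is what linearity of \<open>conv\<close> on sums of tensors will
  need.\<close>

lemma conv_tens:
  fixes g :: "real^'r::finite \<Rightarrow> real \<Rightarrow> real"
  assumes gm: "(\<lambda>(u,t). g u t) \<in> borel_measurable borel"
    and per: "\<And>u t. g u (t + 1) = g u t" and gi: "\<And>u. u \<in> unit_cube \<Longrightarrow> integrable I01 (g u)"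
    and \<eta>: "orthonormal_basis I01 (wav_index m0') (\<lambda>(j,k). \<eta> j k)"
    and k': "\<And>l. (j' l, snd \<kappa> l) \<in> wav_index m0'"
    and \<psi>: "\<psi> j (fst \<kappa>) \<in> L2 I01" "ip I01 (\<psi> j (fst \<kappa>)) (\<psi> j (fst \<kappa>)) = 1"
    and F: "finite F" "\<And>m. m \<notin> F \<Longrightarrow> fourier_coeff (\<psi> j (fst \<kappa>)) m = 0"
    and B: "\<And>u m. u \<in> unit_cube \<Longrightarrow> m \<in> F \<Longrightarrow> (cmod (fourier_coeff (g u) m))\<^sup>2 \<le> B" "B \<ge> 0"
  shows "conv g (tens \<psi> \<eta> j j' \<kappa>) \<in> L2 Dom"
    and "ip Dom (conv g (tens \<psi> \<eta> j j' \<kappa>)) (conv g (tens \<psi> \<eta> j j' \<kappa>)) \<le> B"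
    and "u \<in> unit_cube \<Longrightarrow> integrable I01 (\<lambda>x. g u (t - x) * tens \<psi> \<eta> j j' \<kappa> (u, x))"
proof -
  define h where "h = \<psi> j (fst \<kappa>)"
  define H where "H u = (\<Prod>l\<in>UNIV. \<eta> (j' l) (snd \<kappa> l) (u $ l))" for u :: "real^'r"
  have tens: "tens \<psi> \<eta> j j' \<kappa> (u, x) = h x * H u" for u x by (simp add: tens_def h_def H_def)
  define W where "W p = (\<integral>x. g (fst p) (snd p - x) * h x \<partial>I01)" for p
  have cv: "conv g (tens \<psi> \<eta> j j' \<kappa>) p = W p * H (fst p)" for p
    by (cases p) (simp add: conv_def tens W_def mult.assoc[symmetric])
  have hm [measurable]: "h \<in> borel_measurable I01" using \<psi> by (simp add: h_def L2_def)
  have gum: "g u \<in> borel_measurable borel" for u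
    using measurable_compose[OF measurable_Pair1'[of u borel borel] gm[unfolded borel_prod[symmetric]]]
    by simp
  have hL: "h \<in> L2 I01" and hF: "\<And>m. m \<notin> F \<Longrightarrow> fourier_coeff h m = 0"
    using \<psi> F by (simp_all add: h_def)
  have int: "integrable I01 (\<lambda>x. g u (t - x) * h x)" if "u \<in> unit_cube" for u t
    by (rule convolution_band_limited(1)[OF per gum gi[OF that] hL F(1) hF B(1)[OF that]])
  show "integrable I01 (\<lambda>x. g u (t - x) * tens \<psi> \<eta> j j' \<kappa> (u, x))" if "u \<in> unit_cube" for u t
    unfolding tens mult.assoc[symmetric] using int[OF that] by (intro integrable_mult_left)
  have WB: "(\<integral>\<^sup>+t. ennreal ((W (u, t))\<^sup>2) \<partial>I01) \<le> ennreal B" if "u \<in> unit_cube" for u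
    using convolution_band_limited(2)[OF per gum gi[OF that] hL F(1) hF B(1)[OF that]] \<psi>(2)
    by (simp add: W_def h_def)
  have \<eta>L: "\<eta> a b \<in> L2 I01" if "(a, b) \<in> wav_index m0'" for a b
    using \<eta> that by (auto simp: orthonormal_basis_def)
  have \<eta>o: "(\<integral>x. \<eta> a b x * \<eta> a b x \<partial>I01) = 1" if "(a, b) \<in> wav_index m0'" for a b
    using \<eta> that by (fastforce simp: orthonormal_basis_def ip_def)
  have H1: "has_bochner_integral Cube (\<lambda>u. H u * H u) 1"
    using has_bochner_integral_Cube_prod[of "\<lambda>l x. \<eta> (j' l) (snd \<kappa> l) x * \<eta> (j' l) (snd \<kappa> l) x"]
      L2_integrable_mult[OF \<eta>L[OF k'] \<eta>L[OF k']] \<eta>o[OF k']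
    by (simp add: H_def prod.distrib)
  have "has_bochner_integral Cube H (\<Prod>l\<in>UNIV. \<integral>x. \<eta> (j' l) (snd \<kappa> l) x \<partial>I01)"
    unfolding H_def by (intro has_bochner_integral_Cube_prod L2_I01_integrable \<eta>L k')
  then have Hm [measurable]: "H \<in> borel_measurable Cube" by (auto simp: has_bochner_integral_iff)
  have Hint: "(\<integral>\<^sup>+u. ennreal ((H u)\<^sup>2) \<partial>Cube) = 1"
    using H1 by (subst nn_integral_eq_integral) (auto simp: has_bochner_integral_iff power2_eq_square)
  have idm: "(\<lambda>p. p) \<in> measurable (Dom :: ((real^'r) \<times> real) measure) borel" "(\<lambda>x. x) \<in> measurable I01 borel"
    unfolding Dom_def I01_def by (auto intro: measurable_restrict_space1)
  have [measurable]: "W \<in> borel_measurable Dom"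
    unfolding W_def
  proof (rule I01.borel_measurable_lebesgue_integral)
    have "(\<lambda>q. (fst (fst q), snd (fst q) - snd q)) \<in> measurable (Dom \<Otimes>\<^sub>M I01) (borel :: ((real^'r) \<times> real) measure)"
      unfolding borel_prod[symmetric]
    proof (intro measurable_Pair)
      have 1: "fst \<in> measurable (Dom \<Otimes>\<^sub>M I01) (borel :: ((real^'r) \<times> real) measure)"
        by (rule measurable_compose[OF measurable_fst idm(1)])
      have 2: "snd \<in> measurable ((Dom :: ((real^'r) \<times> real) measure) \<Otimes>\<^sub>M I01) borel"
        by (rule measurable_compose[OF measurable_snd idm(2)])
      have 3: "fst \<in> measurable (borel :: ((real^'r) \<times> real) measure) borel"
          "snd \<in> measurable (borel :: ((real^'r) \<times> real) measure) borel"
        unfolding borel_prod[symmetric] by simp_all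
      show "(\<lambda>q. fst (fst q)) \<in> measurable (Dom \<Otimes>\<^sub>M I01) (borel :: (real^'r) measure)"
        by (rule measurable_compose[OF 1 3(1)])
      show "(\<lambda>q. snd (fst q) - snd q) \<in> measurable ((Dom :: ((real^'r) \<times> real) measure) \<Otimes>\<^sub>M I01) borel"
        by (intro borel_measurable_diff measurable_compose[OF 1 3(2)] 2)
    qed
    from measurable_compose[OF this gm]
    show "(\<lambda>(p, x). g (fst p) (snd p - x) * h x) \<in> borel_measurable (Dom \<Otimes>\<^sub>M I01)"
      by (simp add: case_prod_beta)
  qed
  have [measurable]: "(\<lambda>p. H (fst p)) \<in> borel_measurable Dom"
    unfolding Dom_eq_pair by measurable
  have cm [measurable]: "conv g (tens \<psi> \<eta> j j' \<kappa>) \<in> borel_measurable Dom"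
    using borel_measurable_times[of W Dom "\<lambda>p. H (fst p)"] by (simp add: cv[abs_def])
  have "(\<integral>\<^sup>+p. ennreal ((conv g (tens \<psi> \<eta> j j' \<kappa>) p)\<^sup>2) \<partial>Dom)
     = (\<integral>\<^sup>+u. \<integral>\<^sup>+t. ennreal ((conv g (tens \<psi> \<eta> j j' \<kappa>) (u, t))\<^sup>2) \<partial>I01 \<partial>Cube)"
    unfolding Dom_eq_pair using cm[unfolded Dom_eq_pair]
    by (subst I01.nn_integral_fst) (auto intro: measurable_compose)
  also have "\<dots> \<le> (\<integral>\<^sup>+u. ennreal ((H u)\<^sup>2) * ennreal B \<partial>Cube)"
  proof (rule nn_integral_mono)
    fix u :: "real^'r" assume u: "u \<in> space Cube"
    have Wu: "(\<lambda>t. W (u, t)) \<in> borel_measurable I01"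
      using u \<open>W \<in> borel_measurable Dom\<close> unfolding Dom_eq_pair by (rule measurable_Pair2[rotated])
    have "(\<integral>\<^sup>+t. ennreal ((conv g (tens \<psi> \<eta> j j' \<kappa>) (u, t))\<^sup>2) \<partial>I01)
       = (\<integral>\<^sup>+t. ennreal ((H u)\<^sup>2) * ennreal ((W (u, t))\<^sup>2) \<partial>I01)"
      by (simp add: cv power_mult_distrib ennreal_mult mult.commute)
    also have "\<dots> = ennreal ((H u)\<^sup>2) * (\<integral>\<^sup>+t. ennreal ((W (u, t))\<^sup>2) \<partial>I01)"
      by (intro nn_integral_cmult measurable_compose[OF _ measurable_ennreal] borel_measurable_power Wu)
    also have "\<dots> \<le> ennreal ((H u)\<^sup>2) * ennreal B"
      using u by (intro mult_left_mono WB) auto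
    finally show "(\<integral>\<^sup>+t. ennreal ((conv g (tens \<psi> \<eta> j j' \<kappa>) (u, t))\<^sup>2) \<partial>I01) \<le> ennreal ((H u)\<^sup>2) * ennreal B" .
  qed
  also have "\<dots> = ennreal B" by (simp add: nn_integral_multc Hint)
  finally have le: "(\<integral>\<^sup>+p. ennreal ((conv g (tens \<psi> \<eta> j j' \<kappa>) p)\<^sup>2) \<partial>Dom) \<le> ennreal B" .
  then show L: "conv g (tens \<psi> \<eta> j j' \<kappa>) \<in> L2 Dom"
    using cm by (auto simp: L2_def intro: le_less_trans)
  have "ennreal (ip Dom (conv g (tens \<psi> \<eta> j j' \<kappa>)) (conv g (tens \<psi> \<eta> j j' \<kappa>)))
     = (\<integral>\<^sup>+p. ennreal ((conv g (tens \<psi> \<eta> j j' \<kappa>) p)\<^sup>2) \<partial>Dom)"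
    unfolding ip_def using L2_integrable_mult[OF L L]
    by (subst nn_integral_eq_integral[symmetric]) (auto simp: power2_eq_square)
  then have "ennreal (ip Dom (conv g (tens \<psi> \<eta> j j' \<kappa>)) (conv g (tens \<psi> \<eta> j j' \<kappa>))) \<le> ennreal B"
    using le by (simp only:)
  then show "ip Dom (conv g (tens \<psi> \<eta> j j' \<kappa>)) (conv g (tens \<psi> \<eta> j j' \<kappa>)) \<le> B"
    using B(2) by (simp only: ennreal_le_iff)
qed

section \<open>Besov norms of functions living on one level\<close>

lemma finite_shift_set: "finite (shift_set m0 m0' j (j' :: 'r::finite \<Rightarrow> int))"
proof -
  have "shift_set m0 m0' j j' \<subseteq> {..<2 ^ nat (max j m0)} \<times> Pi\<^sub>E UNIV (\<lambda>l. {..<2 ^ nat (max (j' l) m0')})"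
    by (auto simp: shift_set_def PiE_iff)
  then show ?thesis by (rule finite_subset) (auto intro!: finite_PiE)
qed

text \<open>\<open>N\<close> may exceed the support of \<open>F\<close>. With \<open>N\<close> the
  full set of perturbed positions, one bound covers all vertices of the hypercube.\<close>

lemma lp_norm_le_card:
  assumes p: "1 \<le> p" and S: "finite S" "S \<noteq> {}" and N: "finite N" "N \<noteq> {}"
    and F: "\<And>x. x \<in> S \<Longrightarrow> \<bar>F x\<bar> \<le> (if x \<in> N then \<gamma> else 0)" and \<gamma>: "\<gamma> \<ge> 0"
  shows "lp_norm p F S \<le> \<gamma> * real (card N) powr invp p"
proof -
  \<comment> \<open>For \<open>p = \<infinity>\<close> the exponent \<open>invp p\<close> is 0, and
    \<open>x powr 0\<close> is 1 only for nonzero \<open>x\<close>.\<close>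
  have c: "card N > 0" using N by (simp add: card_gt_0_iff)
  show ?thesis
  proof (cases "p = \<infinity>")
    case True
    have "\<bar>F x\<bar> \<le> \<gamma>" if "x \<in> S" for x using F[OF that] \<gamma> by (auto split: if_splits)
    then show ?thesis using True S c by (simp add: lp_norm_def invp_def)
  next
    case False
    then obtain P where P: "p = ereal P" "P \<ge> 1" using p by (cases p) auto
    have "(\<Sum>x\<in>S. \<bar>F x\<bar> powr P) \<le> (\<Sum>x\<in>S. if x \<in> N then \<gamma> powr P else 0)"
    proof (rule sum_mono)
      fix x assume "x \<in> S"
      from F[OF this] show "\<bar>F x\<bar> powr P \<le> (if x \<in> N then \<gamma> powr P else 0)"
        using P by (auto intro!: powr_mono2 split: if_splits)
    qed
    also have "\<dots> = card (S \<inter> N) * \<gamma> powr P"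
      using S by (simp add: sum.If_cases Int_def)
    also have "\<dots> \<le> card N * \<gamma> powr P"
      using N by (intro mult_right_mono) (auto intro: card_mono)
    finally have "(\<Sum>x\<in>S. \<bar>F x\<bar> powr P) powr (1 / P) \<le> (card N * \<gamma> powr P) powr (1 / P)"
      using P by (intro powr_mono2 sum_nonneg) auto
    also have "\<dots> = \<gamma> * real (card N) powr (1 / P)"
      using P \<gamma> by (simp add: powr_mult powr_powr mult.commute)
    finally show ?thesis using P by (simp add: lp_norm_def invp_def)
  qed
qed

lemma lp_norm_nonneg:
  assumes "finite S" "S \<noteq> {}"
  shows "0 \<le> lp_norm p F S"
proof -
  obtain x where "x \<in> S" using assms by blast
  then have "\<bar>F x\<bar> \<le> Max ((\<lambda>x. \<bar>F x\<bar>) ` S)" using assms by (intro Max_ge) auto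
  then show ?thesis by (simp add: lp_norm_def) (meson abs_ge_zero order_trans)
qed

lemma lp_norm_zero:
  assumes "1 \<le> p" "finite S" "S \<noteq> {}" "\<And>x. x \<in> S \<Longrightarrow> F x = 0"
  shows "lp_norm p F S = 0"
proof (cases "p = \<infinity>")
  case True
  have "(\<lambda>x. \<bar>F x\<bar>) ` S = {0}" using assms by auto
  then show ?thesis using True by (simp add: lp_norm_def)
next
  case False
  then show ?thesis using assms by (cases p) (auto simp: lp_norm_def)
qed

lemma shift_set_nonempty: "shift_set m0 m0' j j' \<noteq> {}"
proof -
  have "(0, \<lambda>_. 0) \<in> shift_set m0 m0' j j'" by (simp add: shift_set_def)
  then show ?thesis by blast
qed

definition level_weight :: "real \<Rightarrow> ('r::finite \<Rightarrow> real) \<Rightarrow> ereal \<Rightarrow> int \<Rightarrow> ('r \<Rightarrow> int) \<Rightarrow> real" where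
  "level_weight s1 s2 p j j' = 2 powr (real_of_int j * (s1 + 1/2 - invp p)
     + (\<Sum>l\<in>UNIV. real_of_int (j' l) * (s2 l + 1/2 - invp p)))"

text \<open>By orthonormality all coefficients off the level \<open>(j, j')\<close> vanish. The
  outer sum or supremum then has a single nonzero term, and the same condition on
  \<open>\<gamma>\<close> serves every \<open>q\<close>.\<close>

lemma besov_ball_one_level:
  fixes j' :: "'r::finite \<Rightarrow> int"
  assumes \<psi>: "orthonormal_basis I01 (wav_index m0) (\<lambda>(j,k). \<psi> j k)"
    and \<eta>: "orthonormal_basis I01 (wav_index m0') (\<lambda>(j,k). \<eta> j k)"
    and p: "1 \<le> p" and q: "1 \<le> q" and \<gamma>: "\<gamma> \<ge> 0" and A: "A > 0"
    and jj: "(j, j') \<in> level_set m0 m0'"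
    and K: "K \<subseteq> shift_set m0 m0' j j'" "K \<noteq> {}" and T: "T \<subseteq> K"
    and bound: "level_weight s1 s2 p j j' * (\<gamma> * real (card K) powr invp p) \<le> A"
  shows "(\<lambda>x. \<Sum>\<kappa>\<in>T. \<gamma> * tens \<psi> \<eta> j j' \<kappa> x) \<in> besov_ball \<psi> \<eta> m0 m0' s1 s2 p q A"
proof -
  let ?f = "\<lambda>x. \<Sum>\<kappa>\<in>T. \<gamma> * tens \<psi> \<eta> j j' \<kappa> x"
  have fK: "finite K" using K finite_shift_set finite_subset by blast
  have fT: "finite T" using T fK finite_subset by blast
  have TS: "\<kappa> \<in> shift_set m0 m0' j j'" if "\<kappa> \<in> T" for \<kappa> using that T K by blast
  note tL = tens_L2_ip(1)[OF \<psi> \<eta> jj _ jj] and ti = tens_L2_ip(2)[OF \<psi> \<eta>]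
  have fL: "?f \<in> L2 Dom" using TS by (intro L2_sum fT L2_scale tL)
  have b: "beta \<psi> \<eta> ?f i (fst \<mu>) i' (snd \<mu>) = (if j = i \<and> j' = i' \<and> \<mu> \<in> T then \<gamma> else 0)"
    if il: "(i, i') \<in> level_set m0 m0'" "\<mu> \<in> shift_set m0 m0' i i'" for i i' \<mu>
  proof -
    have "beta \<psi> \<eta> ?f i (fst \<mu>) i' (snd \<mu>) = (\<Sum>\<kappa>\<in>T. \<gamma> * ip Dom (tens \<psi> \<eta> j j' \<kappa>) (tens \<psi> \<eta> i i' \<mu>))"
      unfolding beta_eq_ip using TS tens_L2_ip(1)[OF \<psi> \<eta> il il]
      by (subst ip_sum_left[OF fT]) (auto intro!: L2_scale tL simp: ip_scale_left)
    also have "\<dots> = (\<Sum>\<kappa>\<in>T. if \<kappa> = \<mu> then (if j = i \<and> j' = i' then \<gamma> else 0) else 0)"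
      by (intro sum.cong refl) (auto simp: ti[OF jj TS il])
    finally show ?thesis using fT by simp
  qed
  define w where "w = (\<lambda>(j,j'). level_weight s1 s2 p j j' *
      lp_norm p (\<lambda>(k,k'). beta \<psi> \<eta> ?f j k j' k') (shift_set m0 m0' j j'))"
  have w0: "w (i, i') = 0" if "(i, i') \<in> level_set m0 m0'" "(i, i') \<noteq> (j, j')" for i i'
    unfolding w_def prod.case using p that b[OF that(1)]
    by (subst lp_norm_zero) (auto intro: finite_shift_set simp: shift_set_nonempty)
  have wj: "w (j, j') \<le> A"
  proof -
    have "lp_norm p (\<lambda>(k,k'). beta \<psi> \<eta> ?f j k j' k') (shift_set m0 m0' j j') \<le> \<gamma> * real (card K) powr invp p"
      using b[OF jj] T \<gamma> by (intro lp_norm_le_card p finite_shift_set shift_set_nonempty fK K(2)) auto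
    then have "w (j, j') \<le> level_weight s1 s2 p j j' * (\<gamma> * real (card K) powr invp p)"
      unfolding w_def prod.case by (intro mult_left_mono) (auto simp: level_weight_def)
    then show ?thesis using bound by simp
  qed
  have wA: "w x \<le> A" if "x \<in> level_set m0 m0'" for x
    using w0[of "fst x" "snd x"] wj that A by (cases "x = (j, j')") auto
  have wnn: "0 \<le> w x" for x
    by (cases x) (auto simp: w_def level_weight_def intro!: mult_nonneg_nonneg lp_norm_nonneg finite_shift_set shift_set_nonempty)
  have fin: "(\<integral>\<^sup>+ x. ennreal (w x powr real_of_ereal q) \<partial>count_space (level_set m0 m0'))
     \<le> ennreal (A powr real_of_ereal q)" if "q \<noteq> \<infinity>"
  proof -
    have q0: "real_of_ereal q \<ge> 0" using q by (cases q) auto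
    have "(\<integral>\<^sup>+ x. ennreal (w x powr real_of_ereal q) \<partial>count_space (level_set m0 m0'))
      \<le> (\<integral>\<^sup>+ x. ennreal (A powr real_of_ereal q) * indicator {(j, j')} x \<partial>count_space (level_set m0 m0'))"
    proof (rule nn_integral_mono)
      fix x assume x: "x \<in> space (count_space (level_set m0 m0' :: (int \<times> ('r \<Rightarrow> int)) set))"
      show "ennreal (w x powr real_of_ereal q) \<le> ennreal (A powr real_of_ereal q) * indicator {(j, j')} x"
      proof (cases "x = (j, j')")
        case True
        then show ?thesis using wj wnn[of x] q0 by (auto intro!: ennreal_leI powr_mono2)
      next
        case False
        then show ?thesis using x w0[of "fst x" "snd x"] by auto
      qed
    qed
    also have "\<dots> = ennreal (A powr real_of_ereal q)"
      using jj by (simp add: nn_integral_cmult_indicator)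
    finally show ?thesis .
  qed
  have unf: "(\<lambda>(j,j'). 2 powr (real_of_int j * (s1 + 1/2 - invp p)
                    + (\<Sum>l\<in>UNIV. real_of_int (j' l) * (s2 l + 1/2 - invp p)))
                  * lp_norm p (\<lambda>(k,k'). beta \<psi> \<eta> ?f j k j' k') (shift_set m0 m0' j j')) = w"
    unfolding w_def level_weight_def ..
  show ?thesis
    unfolding besov_ball_def mem_Collect_eq unf Let_def using fL wA fin by simp
qed

section \<open>Lower bounds from a single level\<close>

text \<open>Bounds \<open>|g\<^sub>m(u)|\<^sup>2\<close> at all frequencies \<open>m\<close> of the wavelets of level \<open>j\<close>.\<close>
definition noise_gain :: "real \<Rightarrow> real \<Rightarrow> real \<Rightarrow> int \<Rightarrow> real" where
  "noise_gain C2 c \<nu> j = C2 * (2 powr real_of_int j / c) powr (- 2 * \<nu>)"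

text \<open>The amplitude meets two constraints: \<open>besov\<close> keeps every vertex in the
  ball, \<open>noise\<close> keeps neighbouring vertices indistinguishable. What remains is to
  maximise \<open>\<gamma>\<^sup>2 * card K\<close> under both.\<close>

lemma minimax_risk_ge_one_level:
  fixes g :: "real^'r::finite \<Rightarrow> real \<Rightarrow> real" and j' :: "'r \<Rightarrow> int"
  assumes p: "1 \<le> p" and q: "1 \<le> q" and A: "A > 0" and \<nu>: "\<nu> > 0" and C1: "0 < C1" and C2: "C1 \<le> C2"
    and g: "\<And>m u. m \<noteq> 0 \<Longrightarrow> u \<in> unit_cube \<Longrightarrow>
           C1 * \<bar>real_of_int m\<bar> powr (-2*\<nu>) \<le> (cmod (fourier_coeff (g u) m))\<^sup>2 \<and>
           (cmod (fourier_coeff (g u) m))\<^sup>2 \<le> C2 * \<bar>real_of_int m\<bar> powr (-2*\<nu>)"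
    and gm: "(\<lambda>(u,t). g u t) \<in> borel_measurable borel" and per: "\<And>u t. g u (t + 1) = g u t"
    and \<psi>: "orthonormal_basis I01 (wav_index m0) (\<lambda>(j,k). \<psi> j k)"
    and \<eta>: "orthonormal_basis I01 (wav_index m0') (\<lambda>(j,k). \<eta> j k)"
    and c: "c > 1" and band: "\<And>k m. (j, k) \<in> wav_index m0 \<Longrightarrow> fourier_coeff (\<psi> j k) m \<noteq> 0 \<Longrightarrow>
         2 powr real_of_int j / c \<le> \<bar>real_of_int m\<bar> \<and> \<bar>real_of_int m\<bar> \<le> c * 2 powr real_of_int j"
    and \<phi>: "orthonormal_basis Dom UNIV \<phi>"
    and jj: "(j, j') \<in> level_set m0 m0'"
    and K: "K \<subseteq> shift_set m0 m0' j j'" "K \<noteq> {}"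
    and \<gamma>: "\<gamma> \<ge> 0" and \<epsilon>: "\<epsilon> > 0"
    and besov: "level_weight s1 s2 p j j' * (\<gamma> * real (card K) powr invp p) \<le> A"
    and noise: "\<gamma>\<^sup>2 * noise_gain C2 c \<nu> j \<le> \<epsilon>\<^sup>2"
  shows "ennreal (\<gamma>\<^sup>2 * card K / 128) \<le> minimax_risk g \<phi> \<epsilon> (besov_ball \<psi> \<eta> m0 m0' s1 s2 p q A)"
proof -
  define L where "L = 2 powr real_of_int j / c"
  have L: "L > 0" using c by (simp add: L_def)
  have fK: "finite K" using K finite_shift_set finite_subset by blast
  have w: "(j, fst \<kappa>) \<in> wav_index m0" "(j' l, snd \<kappa> l) \<in> wav_index m0'" if "\<kappa> \<in> K" for \<kappa> l
    using wav_index_level[OF jj] that K(1) by blast+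
  define F where "F \<kappa> = {m. fourier_coeff (\<psi> j (fst \<kappa>)) m \<noteq> 0}" for \<kappa> :: "nat \<times> ('r \<Rightarrow> nat)"
  have F_fin: "finite (F \<kappa>)" if "\<kappa> \<in> K" for \<kappa>
  proof (rule finite_subset)
    let ?N = "\<lceil>c * 2 powr real_of_int j\<rceil>"
    show "F \<kappa> \<subseteq> {- ?N..?N}"
    proof
      fix m assume "m \<in> F \<kappa>"
      then have "\<bar>real_of_int m\<bar> \<le> c * 2 powr real_of_int j" using band[OF w(1)[OF that]] by (simp add: F_def)
      also have "\<dots> \<le> real_of_int ?N" by (rule le_of_int_ceiling)
      finally have "\<bar>m\<bar> \<le> ?N" by linarith
      then show "m \<in> {- ?N..?N}" by auto
    qed
  qed simp
  \<comment> \<open>Integrability comes from the lower bound on the coefficients; frequency 1 is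
    enough.\<close>
  have gi: "integrable I01 (g u)" if u: "u \<in> unit_cube" for u
  proof (rule integrable_fourier_coeff[of "g u" 1])
    have "0 < C1 * \<bar>real_of_int 1\<bar> powr (-2*\<nu>)" using C1 by simp
    then show "fourier_coeff (g u) 1 \<noteq> 0" using g[OF _ u, of 1] by auto
  qed
  have B0: "noise_gain C2 c \<nu> j \<ge> 0" using C1 C2 by (simp add: noise_gain_def)
  have B: "(cmod (fourier_coeff (g u) m))\<^sup>2 \<le> noise_gain C2 c \<nu> j"
    if \<kappa>: "\<kappa> \<in> K" and u: "u \<in> unit_cube" and m: "m \<in> F \<kappa>" for \<kappa> u m
  proof -
    have mL: "L \<le> \<bar>real_of_int m\<bar>" using band[OF w(1)[OF \<kappa>]] m by (simp add: F_def L_def)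
    then have "m \<noteq> 0" using L by auto
    then have "(cmod (fourier_coeff (g u) m))\<^sup>2 \<le> C2 * \<bar>real_of_int m\<bar> powr (-2*\<nu>)" using g u by blast
    \<comment> \<open>The exponent is negative, so the lowest frequency of the band gives the
      largest value.\<close>
    also have "\<dots> \<le> C2 * L powr (-2*\<nu>)"
      using mL L \<nu> C1 C2 by (intro mult_left_mono powr_mono2') auto
    finally show ?thesis by (simp add: noise_gain_def L_def)
  qed
  have \<psi>L: "\<psi> j (fst \<kappa>) \<in> L2 I01" "ip I01 (\<psi> j (fst \<kappa>)) (\<psi> j (fst \<kappa>)) = 1" if "\<kappa> \<in> K" for \<kappa>
    using \<psi> w(1)[OF that] by (fastforce simp: orthonormal_basis_def)+
  have ct: "conv g (tens \<psi> \<eta> j j' \<kappa>) \<in> L2 Dom"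
      "ip Dom (conv g (tens \<psi> \<eta> j j' \<kappa>)) (conv g (tens \<psi> \<eta> j j' \<kappa>)) \<le> noise_gain C2 c \<nu> j"
      "\<And>u t. u \<in> unit_cube \<Longrightarrow> integrable I01 (\<lambda>x. g u (t - x) * tens \<psi> \<eta> j j' \<kappa> (u, x))"
    if \<kappa>: "\<kappa> \<in> K" for \<kappa>
  proof -
    have F0: "fourier_coeff (\<psi> j (fst \<kappa>)) m = 0" if "m \<notin> F \<kappa>" for m using that by (simp add: F_def)
    note ct = conv_tens[where F = "F \<kappa>" and \<kappa> = \<kappa> and g = g and \<psi> = \<psi> and j = j and j' = j',
      OF gm per gi \<eta> w(2)[OF \<kappa>] \<psi>L[OF \<kappa>] F_fin[OF \<kappa>] F0 B[OF \<kappa>] B0]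
    show "conv g (tens \<psi> \<eta> j j' \<kappa>) \<in> L2 Dom" by (rule ct(1))
    show "ip Dom (conv g (tens \<psi> \<eta> j j' \<kappa>)) (conv g (tens \<psi> \<eta> j j' \<kappa>)) \<le> noise_gain C2 c \<nu> j" by (rule ct(2))
    show "integrable I01 (\<lambda>x. g u (t - x) * tens \<psi> \<eta> j j' \<kappa> (u, x))" if "u \<in> unit_cube" for u t
      using that by - (rule ct(3); assumption)
  qed
  have KS: "\<kappa> \<in> shift_set m0 m0' j j'" if "\<kappa> \<in> K" for \<kappa> using K that by blast
  show ?thesis
  proof (rule minimax_risk_ge_hypercube[OF \<phi> \<epsilon> \<gamma> fK, where b = "tens \<psi> \<eta> j j'"])
    fix \<kappa> assume \<kappa>: "\<kappa> \<in> K"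
    show "tens \<psi> \<eta> j j' \<kappa> \<in> L2 Dom" by (rule tens_L2_ip(1)[OF \<psi> \<eta> jj KS[OF \<kappa>] jj KS[OF \<kappa>]])
    show "conv g (tens \<psi> \<eta> j j' \<kappa>) \<in> L2 Dom" by (rule ct(1)[OF \<kappa>])
    show "\<gamma>\<^sup>2 * ip Dom (conv g (tens \<psi> \<eta> j j' \<kappa>)) (conv g (tens \<psi> \<eta> j j' \<kappa>)) \<le> \<epsilon>\<^sup>2"
      using mult_left_mono[OF ct(2)[OF \<kappa>], of "\<gamma>\<^sup>2"] noise by simp
    fix \<mu> assume \<mu>: "\<mu> \<in> K"
    show "ip Dom (tens \<psi> \<eta> j j' \<kappa>) (tens \<psi> \<eta> j j' \<mu>) = (if \<kappa> = \<mu> then 1 else 0)"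
      using tens_L2_ip(2)[OF \<psi> \<eta> jj KS[OF \<kappa>] jj KS[OF \<mu>]] by simp
  next
    fix T assume T: "T \<subseteq> K"
    show "(\<lambda>x. \<Sum>\<kappa>\<in>T. \<gamma> * tens \<psi> \<eta> j j' \<kappa> x) \<in> besov_ball \<psi> \<eta> m0 m0' s1 s2 p q A"
      by (rule besov_ball_one_level[OF \<psi> \<eta> p q \<gamma> A jj K T besov])
    fix x :: "(real^'r) \<times> real" assume "x \<in> space Dom"
    then obtain u t where x: "x = (u, t)" "u \<in> unit_cube" by auto
    have "conv g (\<lambda>x. \<Sum>\<kappa>\<in>T. \<gamma> * tens \<psi> \<eta> j j' \<kappa> x) x
       = (\<integral>y. (\<Sum>\<kappa>\<in>T. \<gamma> * (g u (t - y) * tens \<psi> \<eta> j j' \<kappa> (u, y))) \<partial>I01)"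
      by (simp add: x conv_def sum_distrib_left mult_ac)
    also have "\<dots> = (\<Sum>\<kappa>\<in>T. \<gamma> * (\<integral>y. g u (t - y) * tens \<psi> \<eta> j j' \<kappa> (u, y) \<partial>I01))"
      using T x(2) ct(3) by (subst Bochner_Integration.integral_sum) auto
    finally show "conv g (\<lambda>x. \<Sum>\<kappa>\<in>T. \<gamma> * tens \<psi> \<eta> j j' \<kappa> x) x = (\<Sum>\<kappa>\<in>T. \<gamma> * conv g (tens \<psi> \<eta> j j' \<kappa>) x)"
      by (simp add: x conv_def)
  qed
qed

text \<open>At level \<open>n\<close> the Besov constraint allows amplitudes up to order \<open>A 2^(-n\<tau>)\<close>, the operator
  attenuates by \<open>2^(-n\<mu>)\<close>, and \<open>2^(n(2\<tau>-2\<sigma>))\<close> coefficients are perturbed; \<open>n\<close> is chosen to balance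
  \<open>2^(-n(2\<tau>+2\<mu>))\<close> against \<open>\<epsilon>\<^sup>2 / A\<^sup>2\<close>.\<close>
lemma rate_from_levels:
  fixes R :: "real \<Rightarrow> ennreal" and \<tau> \<mu> \<sigma> W G A :: real
  assumes A: "A > 0" and W: "W > 0" and G: "G > 0" and a: "2 * \<tau> + 2 * \<mu> > 0" and \<sigma>: "\<sigma> \<ge> 0"
    and lower: "\<And>n \<gamma> \<epsilon>. n \<ge> n0 \<Longrightarrow> \<gamma> \<ge> 0 \<Longrightarrow> \<epsilon> > 0 \<Longrightarrow> W * 2 powr (real n * \<tau>) * \<gamma> \<le> A \<Longrightarrow>
       \<gamma>\<^sup>2 * (G * 2 powr (- 2 * real n * \<mu>)) \<le> \<epsilon>\<^sup>2 \<Longrightarrow>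
       ennreal (\<gamma>\<^sup>2 * 2 powr (real n * (2 * \<tau> - 2 * \<sigma>)) / 128) \<le> R \<epsilon>"
  shows "\<exists>C>0. \<forall>\<^sub>F \<epsilon> in at_right 0. ennreal (C * A\<^sup>2 * (\<epsilon>\<^sup>2 / A\<^sup>2) powr (2 * \<sigma> / (2 * \<tau> + 2 * \<mu>))) \<le> R \<epsilon>"
proof -
  define a where "a = 2 * \<tau> + 2 * \<mu>"
  \<comment> \<open>The amplitude will be \<open>d * A * 2 powr (- real n * \<tau>)\<close>:
    \<open>d * W \<le> 1\<close> is what the Besov constraint asks of \<open>d\<close>, and
    \<open>d\<^sup>2 * G \<le> 1\<close> what the noise constraint asks.\<close>
  define d where "d = min (1 / W) (1 / sqrt G)"
  have a0: "a > 0" using a by (simp add: a_def)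
  have d: "d > 0" "d * W \<le> 1" "d\<^sup>2 * G \<le> 1"
  proof -
    show "d > 0" using W G by (simp add: d_def)
    then have "d * W \<le> 1 / W * W" using W by (intro mult_right_mono) (auto simp: d_def)
    then show "d * W \<le> 1" using W by simp
    have "d\<^sup>2 \<le> (1 / sqrt G)\<^sup>2" using \<open>d > 0\<close> by (intro power_mono) (auto simp: d_def)
    then have "d\<^sup>2 * G \<le> (1 / sqrt G)\<^sup>2 * G" using G by (intro mult_right_mono) auto
    then show "d\<^sup>2 * G \<le> 1" using G by (simp add: power_divide)
  qed
  \<comment> \<open>The factor \<open>2 powr (- 2 * \<sigma>)\<close> pays for rounding the ideal
    level up to an integer.\<close>
  define C where "C = d\<^sup>2 * 2 powr (- 2 * \<sigma>) / 128"
  have C: "C > 0" using d by (simp add: C_def)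
  \<comment> \<open>At this noise the ideal level is exactly \<open>n0\<close>; smaller noise pushes
    it higher.\<close>
  define \<epsilon>0 where "\<epsilon>0 = A * 2 powr (- a * real n0 / 2)"
  have \<epsilon>0: "\<epsilon>0 > 0" using A by (simp add: \<epsilon>0_def)
  have main: "ennreal (C * A\<^sup>2 * (\<epsilon>\<^sup>2 / A\<^sup>2) powr (2 * \<sigma> / a)) \<le> R \<epsilon>" if \<epsilon>: "0 < \<epsilon>" "\<epsilon> < \<epsilon>0" for \<epsilon>
  proof -
    define e where "e = \<epsilon>\<^sup>2 / A\<^sup>2"
    have e: "e > 0" using \<epsilon> A by (simp add: e_def)
    \<comment> \<open>The real level at which \<open>2 powr (- a * y)\<close> equals
      \<open>\<epsilon>\<^sup>2 / A\<^sup>2\<close>. Its ceiling is used: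
      \<open>real n \<ge> y\<close> secures the noise constraint, and
      \<open>real n \<le> y + 1\<close> loses only a constant in the rate.\<close>
    define y where "y = - log 2 e / a"
    have ey: "e = 2 powr (- a * y)" using e a0 by (simp add: y_def)
    have "e < (\<epsilon>0)\<^sup>2 / A\<^sup>2"
      unfolding e_def using \<epsilon> A by (intro divide_strict_right_mono power_strict_mono) auto
    also have "\<dots> = 2 powr (- a * real n0)"
      using A by (simp add: \<epsilon>0_def power_mult_distrib power2_eq_square flip: powr_add)
    finally have "- a * y < - a * real n0" unfolding ey by simp
    then have y0: "y > real n0" using a0 by simp
    define n where "n = nat \<lceil>y\<rceil>"
    have n: "real n \<ge> y" "real n \<le> y + 1" "n \<ge> n0" using y0 by (auto simp: n_def le_nat_iff; linarith)+
    define \<gamma> where "\<gamma> = d * A * 2 powr (- real n * \<tau>)"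
    have \<gamma>: "\<gamma> \<ge> 0" using d A by (simp add: \<gamma>_def)
    have \<gamma>2: "\<gamma>\<^sup>2 = d\<^sup>2 * A\<^sup>2 * 2 powr (- 2 * real n * \<tau>)"
      by (simp add: \<gamma>_def power_mult_distrib power2_eq_square[of "2 powr _"] mult_ac flip: powr_add)
    have "W * 2 powr (real n * \<tau>) * \<gamma> = (d * W) * A * (2 powr (real n * \<tau>) * 2 powr (- real n * \<tau>))"
      by (simp add: \<gamma>_def)
    also have "\<dots> = (d * W) * A" by (simp flip: powr_add)
    also have "\<dots> \<le> 1 * A" using d A by (intro mult_right_mono) auto
    finally have 1: "W * 2 powr (real n * \<tau>) * \<gamma> \<le> A" by simp
    have "\<gamma>\<^sup>2 * (G * 2 powr (- 2 * real n * \<mu>))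
       = (d\<^sup>2 * G) * A\<^sup>2 * (2 powr (- 2 * real n * \<tau>) * 2 powr (- 2 * real n * \<mu>))"
      by (simp add: \<gamma>2)
    also have "\<dots> = (d\<^sup>2 * G) * (A\<^sup>2 * 2 powr (- a * real n))"
      by (simp add: a_def algebra_simps flip: powr_add)
    also have "\<dots> \<le> 1 * (A\<^sup>2 * e)"
      unfolding ey using d G A n(1) a0 by (intro mult_mono) auto
    also have "\<dots> = \<epsilon>\<^sup>2" using A by (simp add: e_def)
    finally have 2: "\<gamma>\<^sup>2 * (G * 2 powr (- 2 * real n * \<mu>)) \<le> \<epsilon>\<^sup>2" .
    have "C * A\<^sup>2 * e powr (2 * \<sigma> / a) = d\<^sup>2 * A\<^sup>2 / 128 * 2 powr (- 2 * \<sigma> * (y + 1))"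
    proof -
      have "e powr (2 * \<sigma> / a) = 2 powr (- 2 * \<sigma> * y)"
        unfolding ey powr_powr using a0 by (simp add: mult_ac)
      moreover have "2 powr (- 2 * \<sigma> * (y + 1)) = 2 powr (- 2 * \<sigma>) * 2 powr (- 2 * \<sigma> * y)"
        unfolding powr_add[symmetric] by (simp add: algebra_simps)
      ultimately show ?thesis by (simp only: C_def) simp
    qed
    also have "\<dots> \<le> d\<^sup>2 * A\<^sup>2 / 128 * 2 powr (- 2 * \<sigma> * real n)"
      using n(2) \<sigma> by (intro mult_left_mono) (auto intro: mult_left_mono)
    also have "\<dots> = \<gamma>\<^sup>2 * 2 powr (real n * (2 * \<tau> - 2 * \<sigma>)) / 128"
    proof -
      have "2 powr (- 2 * real n * \<tau>) * 2 powr (real n * (2 * \<tau> - 2 * \<sigma>)) = 2 powr (- 2 * \<sigma> * real n)"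
        unfolding powr_add[symmetric] by (simp add: algebra_simps)
      then show ?thesis by (simp add: \<gamma>2 mult.assoc)
    qed
    finally have "ennreal (C * A\<^sup>2 * e powr (2 * \<sigma> / a)) \<le> ennreal (\<gamma>\<^sup>2 * 2 powr (real n * (2 * \<tau> - 2 * \<sigma>)) / 128)"
      by (rule ennreal_leI)
    also have "\<dots> \<le> R \<epsilon>" using lower[OF n(3) \<gamma> \<epsilon>(1) 1 2] .
    finally show ?thesis by (simp add: e_def)
  qed
  then show ?thesis unfolding a_def[symmetric] using C \<epsilon>0
    by (intro exI[of _ C]) (auto simp: eventually_at_right_field)
qed

theorem theorem4:
  fixes s1 :: real and s2 :: "'r::finite \<Rightarrow> real" and p q :: ereal
    and A \<nu> C1 C2 :: real and g :: "real^'r \<Rightarrow> real \<Rightarrow> real"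
    and m0 m0' :: int and s0 :: nat and \<psi> \<eta> :: "int \<Rightarrow> nat \<Rightarrow> real \<Rightarrow> real"
    and \<phi> :: "nat \<Rightarrow> (real^'r) \<times> real \<Rightarrow> real"
  assumes "s1 > 0" and "\<forall>l. s2 l > 0"
    and "1 \<le> p" and "1 \<le> q"
    and "min s1 (Min (range s2)) \<ge> max (invp p) (1/2)"
    and "A > 0"
    and "\<nu> > 0" and "0 < C1" and "C1 \<le> C2"
    and "\<forall>m::int. m \<noteq> 0 \<longrightarrow> (\<forall>u\<in>unit_cube.
           C1 * \<bar>real_of_int m\<bar> powr (-2*\<nu>) \<le> (cmod (fourier_coeff (g u) m))\<^sup>2 \<and>
           (cmod (fourier_coeff (g u) m))\<^sup>2 \<le> C2 * \<bar>real_of_int m\<bar> powr (-2*\<nu>))"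
    and "(\<lambda>(u,t). g u t) \<in> borel_measurable borel"
    and "\<forall>u t. g u (t + 1) = g u t"
    and "band_limited_basis m0 \<psi>"
    and "compact_regular_basis m0' s0 \<eta>" and "\<forall>l. s2 l \<le> real s0"
    and "orthonormal_basis Dom UNIV \<phi>"
  shows "\<exists>C>0. \<forall>\<^sub>F \<epsilon> in at_right 0.
           minimax_risk g \<phi> \<epsilon> (besov_ball \<psi> \<eta> m0 m0' s1 s2 p q A)
           \<ge> ennreal (C * A\<^sup>2 * (\<epsilon>\<^sup>2 / A\<^sup>2) powr
               (min (min (2 * Min (range s2) / (2 * Min (range s2) + 1))
                         (2 * s1 / (2 * s1 + 2 * \<nu> + 1)))
                    (2 * (s1 + 1/2 - max (invp p) (1/2))
                       / (2 * (s1 + 1/2 - max (invp p) (1/2)) + 2 * \<nu>))))"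
proof -
  let ?R = "\<lambda>\<epsilon>. minimax_risk g \<phi> \<epsilon> (besov_ball \<psi> \<eta> m0 m0' s1 s2 p q A)"
  define rate where "rate D \<longleftrightarrow> (\<exists>C>0. \<forall>\<^sub>F \<epsilon> in at_right 0. ennreal (C * A\<^sup>2 * (\<epsilon>\<^sup>2 / A\<^sup>2) powr D) \<le> ?R \<epsilon>)" for D
  from \<open>band_limited_basis m0 \<psi>\<close> obtain c where \<psi>: "orthonormal_basis I01 (wav_index m0) (\<lambda>(j,k). \<psi> j k)"
    and c: "c > 1" and band': "\<And>j k m. (j, k) \<in> wav_index m0 \<Longrightarrow> fourier_coeff (\<psi> j k) m \<noteq> 0 \<Longrightarrow>
        (if j = m0 - 1 then \<bar>real_of_int m\<bar> \<le> c * 2 powr real_of_int m0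
         else 2 powr real_of_int j / c \<le> \<bar>real_of_int m\<bar> \<and> \<bar>real_of_int m\<bar> \<le> c * 2 powr real_of_int j)"
    unfolding band_limited_basis_def by fast
  have \<eta>: "orthonormal_basis I01 (wav_index m0') (\<lambda>(j,k). \<eta> j k)"
    using \<open>compact_regular_basis m0' s0 \<eta>\<close> by (simp add: compact_regular_basis_def)
  have C2: "C2 > 0" using assms(8,9) by simp
  have ip1: "invp p \<le> s1" and s1: "s1 \<ge> 1/2" using assms(5) by auto
  have level: "ennreal (\<gamma>\<^sup>2 * card K / 128) \<le> ?R \<epsilon>"
    if "j \<ge> m0" "\<And>l. j' l \<ge> m0' - 1" "K \<subseteq> shift_set m0 m0' j j'" "K \<noteq> {}" "\<gamma> \<ge> 0" "\<epsilon> > 0"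
      "level_weight s1 s2 p j j' * (\<gamma> * real (card K) powr invp p) \<le> A"
      "\<gamma>\<^sup>2 * noise_gain C2 c \<nu> j \<le> \<epsilon>\<^sup>2" for j j' K \<gamma> \<epsilon>
  proof (rule minimax_risk_ge_one_level[OF assms(3,4,6-9) _ assms(11) _ \<psi> \<eta> c _ assms(16) _ that(3-8)])
    show "(j, j') \<in> level_set m0 m0'" using that by (auto simp: level_set_def)
    show "2 powr real_of_int j / c \<le> \<bar>real_of_int m\<bar> \<and> \<bar>real_of_int m\<bar> \<le> c * 2 powr real_of_int j"
      if "(j, k) \<in> wav_index m0" "fourier_coeff (\<psi> j k) m \<noteq> 0" for k m
      using band'[OF that] \<open>j \<ge> m0\<close> by auto
  qed (use assms(10,12) in auto)
  \<comment> \<open>The power of \<open>c\<close> comes from the lower edge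
    \<open>2 powr j / c\<close> of the frequency band.\<close>
  define G where "G = C2 * c powr (2 * \<nu>)"
  have G: "G > 0" using C2 c by (simp add: G_def)
  have gain: "noise_gain C2 c \<nu> (int n) = G * 2 powr (- 2 * real n * \<nu>)" for n
  proof -
    have "(2 powr real n / c) powr (- 2 * \<nu>) = (2 powr real n) powr (- 2 * \<nu>) * c powr (2 * \<nu>)"
      using c by (simp add: powr_divide powr_minus field_simps)
    then show ?thesis by (simp add: noise_gain_def G_def powr_powr mult_ac)
  qed
  \<comment> \<open>With all spatial levels held at \<open>m0'\<close>, their share of the Besov
    weight is constant in \<open>n\<close>.\<close>
  define W where "W = 2 powr (\<Sum>l\<in>(UNIV::'r set). real_of_int m0' * (s2 l + 1/2 - invp p))"
  have weight: "level_weight s1 s2 p (int n) (\<lambda>_. m0') = W * 2 powr (real n * (s1 + 1/2 - invp p))" for n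
    by (simp add: level_weight_def W_def powr_add)
  \<comment> \<open>The \<open>2 ^ n\<close> equal coefficients multiply the inner norm by
    \<open>2 powr (real n * invp p)\<close>, which cancels the \<open>- invp p\<close> in the
    weight; hence \<open>\<tau> = s1 + 1/2\<close>. With \<open>\<sigma> = s1\<close> the count
    \<open>2 powr (real n * (2 * \<tau> - 2 * \<sigma>))\<close> is \<open>2 ^ n\<close>.\<close>
  have dense_t: "rate (2 * s1 / (2 * (s1 + 1/2) + 2 * \<nu>))"
    unfolding rate_def
  proof (rule rate_from_levels[where W = W and G = G and ?n0.0 = "nat m0"])
    fix n :: nat and \<gamma> \<epsilon> :: real
    assume n: "n \<ge> nat m0" and \<gamma>: "\<gamma> \<ge> 0" "\<epsilon> > 0" and 1: "W * 2 powr (real n * (s1 + 1/2)) * \<gamma> \<le> A"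
      and 2: "\<gamma>\<^sup>2 * (G * 2 powr (- 2 * real n * \<nu>)) \<le> \<epsilon>\<^sup>2"
    define K where "K = (\<lambda>k::nat. (k, \<lambda>_::'r. 0::nat)) ` {..<2^n}"
    have cK: "card K = 2 ^ n" unfolding K_def by (subst card_image) (auto simp: inj_on_def)
    have KS: "K \<subseteq> shift_set m0 m0' (int n) (\<lambda>_. m0')" using n by (auto simp: K_def shift_set_def)
    have Kne: "K \<noteq> {}" using cK by auto
    have cKr: "real (card K) = 2 powr real n" by (simp add: cK powr_realpow)
    have "level_weight s1 s2 p (int n) (\<lambda>_. m0') * (\<gamma> * real (card K) powr invp p)
       = W * (2 powr (real n * (s1 + 1/2 - invp p)) * 2 powr (real n * invp p)) * \<gamma>"
      unfolding weight cKr powr_powr by simp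
    also have "\<dots> = W * 2 powr (real n * (s1 + 1/2)) * \<gamma>"
      unfolding powr_add[symmetric] by (simp add: algebra_simps)
    finally have "level_weight s1 s2 p (int n) (\<lambda>_. m0') * (\<gamma> * real (card K) powr invp p) \<le> A" using 1 by (simp only:)
    from level[OF _ _ KS Kne \<gamma> this] n 2
    show "ennreal (\<gamma>\<^sup>2 * 2 powr (real n * (2 * (s1 + 1/2) - 2 * s1)) / 128) \<le> ?R \<epsilon>"
      by (simp add: gain cKr algebra_simps)
  qed (use assms G s1 in \<open>auto simp: W_def\<close>)
  \<comment> \<open>A single coefficient: the count is 1, so \<open>\<sigma> = \<tau>\<close>, and
    the \<open>- invp p\<close> of the weight survives. \<open>invp p \<le> s1\<close> makes
    \<open>\<sigma>\<close> nonnegative.\<close>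
  have sparse_t: "rate (2 * (s1 + 1/2 - invp p) / (2 * (s1 + 1/2 - invp p) + 2 * \<nu>))"
    unfolding rate_def
  proof (rule rate_from_levels[where W = W and G = G and ?n0.0 = "nat m0"])
    fix n :: nat and \<gamma> \<epsilon> :: real
    assume n: "n \<ge> nat m0" and \<gamma>: "\<gamma> \<ge> 0" "\<epsilon> > 0" and 1: "W * 2 powr (real n * (s1 + 1/2 - invp p)) * \<gamma> \<le> A"
      and 2: "\<gamma>\<^sup>2 * (G * 2 powr (- 2 * real n * \<nu>)) \<le> \<epsilon>\<^sup>2"
    have KS: "{(0, \<lambda>_. 0)} \<subseteq> shift_set m0 m0' (int n) (\<lambda>_. m0')" by (auto simp: shift_set_def)
    from level[OF _ _ KS _ \<gamma>] n 1 2
    show "ennreal (\<gamma>\<^sup>2 * 2 powr (real n * (2 * (s1 + 1/2 - invp p) - 2 * (s1 + 1/2 - invp p))) / 128) \<le> ?R \<epsilon>"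
      by (simp add: gain weight)
  qed (use assms G s1 ip1 in \<open>auto simp: W_def\<close>)
  have "Min (range s2) \<in> range s2" by (intro Min_in) auto
  then obtain l where l: "Min (range s2) = s2 l" by (rule rangeE)
  have s2l: "s2 l > 0" using assms(2) by blast
  \<comment> \<open>The level in \<open>t\<close> stays at \<open>m0\<close>, so the attenuation
    does not vary with \<open>n\<close>: \<open>\<mu> = 0\<close>, and
    \<open>noise_gain C2 c \<nu> m0\<close> takes the place of \<open>G\<close>. The weight cancels
    against the \<open>2 ^ n\<close> coefficients as in \<open>dense_t\<close>, now in the
    coordinate \<open>l\<close>.\<close>
  have dense_u: "rate (2 * s2 l / (2 * (s2 l + 1/2) + 2 * 0))"
    unfolding rate_def
  proof (rule rate_from_levels[where ?n0.0 = "nat m0'"])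
    define W' where "W' = 2 powr (real_of_int m0 * (s1 + 1/2 - invp p)
       + (\<Sum>i\<in>UNIV - {l}. real_of_int m0' * (s2 i + 1/2 - invp p)))"
    show "W' > 0" by (simp add: W'_def)
    show "noise_gain C2 c \<nu> m0 > 0" using C2 c by (simp add: noise_gain_def)
    fix n :: nat and \<gamma> \<epsilon> :: real
    assume n: "n \<ge> nat m0'" and \<gamma>: "\<gamma> \<ge> 0" "\<epsilon> > 0" and 1: "W' * 2 powr (real n * (s2 l + 1/2)) * \<gamma> \<le> A"
      and 2: "\<gamma>\<^sup>2 * (noise_gain C2 c \<nu> m0 * 2 powr (- 2 * real n * 0)) \<le> \<epsilon>\<^sup>2"
    define j' where "j' = (\<lambda>_. m0')(l := int n)"
    define K where "K = (\<lambda>k::nat. (0::nat, (\<lambda>_. 0::nat)(l := k))) ` {..<2^n}"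
    have "inj_on (\<lambda>k::nat. (0::nat, (\<lambda>_. 0::nat)(l := k))) {..<2^n}"
      by (rule inj_onI) (auto dest: fun_cong[of _ _ l])
    then have cK: "card K = 2 ^ n" unfolding K_def by (simp add: card_image)
    have KS: "K \<subseteq> shift_set m0 m0' m0 j'" using n by (auto simp: K_def shift_set_def j'_def)
    have Kne: "K \<noteq> {}" using cK by auto
    have cKr: "real (card K) = 2 powr real n" by (simp add: cK powr_realpow)
    have "(\<Sum>i\<in>UNIV. real_of_int (j' i) * (s2 i + 1/2 - invp p))
       = real n * (s2 l + 1/2 - invp p) + (\<Sum>i\<in>UNIV - {l}. real_of_int m0' * (s2 i + 1/2 - invp p))"
      by (subst sum.remove[of _ l]) (auto simp: j'_def intro!: sum.cong)
    then have wt: "level_weight s1 s2 p m0 j' = W' * 2 powr (real n * (s2 l + 1/2 - invp p))"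
      by (simp add: level_weight_def W'_def powr_add mult_ac)
    have "level_weight s1 s2 p m0 j' * (\<gamma> * real (card K) powr invp p)
       = W' * (2 powr (real n * (s2 l + 1/2 - invp p)) * 2 powr (real n * invp p)) * \<gamma>"
      unfolding wt cKr powr_powr by simp
    also have "\<dots> = W' * 2 powr (real n * (s2 l + 1/2)) * \<gamma>"
      unfolding powr_add[symmetric] by (simp add: algebra_simps)
    finally have "level_weight s1 s2 p m0 j' * (\<gamma> * real (card K) powr invp p) \<le> A" using 1 by (simp only:)
    moreover have "m0' - 1 \<le> j' i" for i using n by (auto simp: j'_def)
    ultimately have "ennreal (\<gamma>\<^sup>2 * card K / 128) \<le> ?R \<epsilon>"
      using level[OF _ _ KS Kne \<gamma>] 2 by simp
    then show "ennreal (\<gamma>\<^sup>2 * 2 powr (real n * (2 * (s2 l + 1/2) - 2 * s2 l)) / 128) \<le> ?R \<epsilon>"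
      by (simp add: cKr algebra_simps)
  qed (use assms(6) s2l in auto)
  let ?D1 = "2 * s2 l / (2 * s2 l + 1)" and ?D2 = "2 * s1 / (2 * s1 + 2 * \<nu> + 1)"
    and ?D3 = "2 * (s1 + 1/2 - max (invp p) (1/2)) / (2 * (s1 + 1/2 - max (invp p) (1/2)) + 2 * \<nu>)"
  have 1: "rate ?D1" and 2: "rate ?D2" using dense_u dense_t by (simp_all add: algebra_simps)
  \<comment> \<open>For \<open>p \<ge> 2\<close> the sparse exponent is never the smallest one.\<close>
  have 3: "?D2 \<le> ?D3 \<or> rate ?D3"
  proof (cases "invp p \<le> 1/2")
    case True
    then have "?D3 = 2 * s1 / (2 * s1 + 2 * \<nu>)" by (simp add: max_def)
    moreover have "?D2 \<le> 2 * s1 / (2 * s1 + 2 * \<nu>)"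
      using assms(1,7) by (intro divide_left_mono) auto
    ultimately show ?thesis by simp
  next
    case False
    then show ?thesis using sparse_t by (simp add: max_def)
  qed
  \<comment> \<open>The minimum is one of the three exponents; when \<open>?D2 \<le> ?D3\<close> it
    is already attained by \<open>?D1\<close> or \<open>?D2\<close>.\<close>
  have "rate (min (min ?D1 ?D2) ?D3)" using 1 2 3 unfolding min_def by auto
  then show ?thesis unfolding rate_def l .
qed

end
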